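(* If $G$ is a series-parallel graph without loops or bridges, then \[ \alpha(G)\,\alpha^*(G) \geq \tau(G)^2. \]
   Context: Graphs are finite and may have multiple edges (and, in general, loops and bridges). A graph is series-parallel if it has no $K_4$-minor; equivalently, if each of its blocks is either a single edge or can be reduced to a loop by a sequence of operations each of which is the suppression of a vertex of degree two or the elimination of an edge in parallel to another edge. A spanning tree of $G$ is a set of edges inducing a connected spanning subgraph of $G$ and containing no cycle; $\tau(G)$ is the number of spanning trees of $G$. An orientation of $G$ assigns a direction to each edge; it is acyclic if the resulting directed graph has no directed cycle, and totally cyclic if every edge is contained in a directed cycle. $\alpha(G)$ is the number of acyclic orientations of $G$ and $\alpha^*(G)$ is the number of totally cyclic orientations of $G$. *)

theory Defs
  imports "Graph_Theory.Arc_Walk" "HOL-Library.FuncSet"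
begin

text \<open>
  Undirected multigraphs. Every edge has its set of ends: a two-element set for an ordinary
  edge, a singleton for a loop. Distinct edges with the same ends are parallel.
\<close>

record ('v, 'e) multigraph =
  mverts :: "'v set"
  medges :: "'e set"
  mends :: "'e \<Rightarrow> 'v set"

definition finite_multigraph :: "('v, 'e) multigraph \<Rightarrow> bool" where
  "finite_multigraph G \<longleftrightarrow> finite (mverts G) \<and> finite (medges G) \<and>
     (\<forall>e\<in>medges G. mends G e \<subseteq> mverts G \<and> card (mends G e) \<in> {1, 2})"

definition is_loop :: "('v, 'e) multigraph \<Rightarrow> 'e \<Rightarrow> bool" where
  "is_loop G e \<longleftrightarrow> e \<in> medges G \<and> card (mends G e) = 1"

definition adj_rel :: "('v, 'e) multigraph \<Rightarrow> ('v \<times> 'v) set" where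
  "adj_rel G = {(u, v). \<exists>e\<in>medges G. mends G e = {u, v}}"

definition joined :: "('v, 'e) multigraph \<Rightarrow> 'v \<Rightarrow> 'v \<Rightarrow> bool" where
  "joined G u v \<longleftrightarrow> (u, v) \<in> (adj_rel G)\<^sup>*"

definition connected_multigraph :: "('v, 'e) multigraph \<Rightarrow> bool" where
  "connected_multigraph G \<longleftrightarrow> (\<forall>u\<in>mverts G. \<forall>v\<in>mverts G. joined G u v)"

text \<open>
  The cycle running through the vertices \<open>vs\<close> in this cyclic order, where the edge \<open>es ! i\<close>
  leads from \<open>vs ! i\<close> to its cyclic successor. A loop is a cycle of length one and two parallel
  edges form a cycle of length two.
\<close>

definition is_cycle :: "('v, 'e) multigraph \<Rightarrow> 'v list \<Rightarrow> 'e list \<Rightarrow> bool" where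
  "is_cycle G vs es \<longleftrightarrow> es \<noteq> [] \<and> length vs = length es \<and> distinct vs \<and> distinct es \<and>
     set vs \<subseteq> mverts G \<and> set es \<subseteq> medges G \<and>
     (\<forall>i<length es. mends G (es ! i) = {vs ! i, vs ! (Suc i mod length vs)})"

definition delete_edge :: "('v, 'e) multigraph \<Rightarrow> 'e \<Rightarrow> ('v, 'e) multigraph" where
  "delete_edge G e = G\<lparr>medges := medges G - {e}\<rparr>"

definition delete_vertex :: "('v, 'e) multigraph \<Rightarrow> 'v \<Rightarrow> ('v, 'e) multigraph" where
  "delete_vertex G v = G\<lparr>mverts := mverts G - {v}, medges := {e \<in> medges G. v \<notin> mends G e}\<rparr>"

text \<open>
  Contraction of an edge \<open>e\<close> with distinct ends \<open>u\<close> and \<open>v\<close>; the vertex resulting from the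
  identification of \<open>u\<close> and \<open>v\<close> is called \<open>u\<close>. Edges parallel to \<open>e\<close> become loops.
\<close>

definition contract_edge :: "('v, 'e) multigraph \<Rightarrow> 'e \<Rightarrow> 'v \<Rightarrow> 'v \<Rightarrow> ('v, 'e) multigraph" where
  "contract_edge G e u v =
     \<lparr>mverts = mverts G - {v}, medges = medges G - {e},
      mends = (\<lambda>f. (\<lambda>x. if x = v then u else x) ` mends G f)\<rparr>"

definition is_bridge :: "('v, 'e) multigraph \<Rightarrow> 'e \<Rightarrow> bool" where
  "is_bridge G e \<longleftrightarrow> e \<in> medges G \<and>
     (\<exists>u v. mends G e = {u, v} \<and> \<not> joined (delete_edge G e) u v)"

text \<open>\<open>minor_of H G\<close>: \<open>H\<close> arises from \<open>G\<close> by deleting edges and vertices and contracting edges.\<close>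

inductive minor_of :: "('v, 'e) multigraph \<Rightarrow> ('v, 'e) multigraph \<Rightarrow> bool"
  for H :: "('v, 'e) multigraph" where
  minor_refl: "minor_of H H"
| minor_delete_edge: "e \<in> medges G \<Longrightarrow> minor_of H (delete_edge G e) \<Longrightarrow> minor_of H G"
| minor_delete_vertex: "v \<in> mverts G \<Longrightarrow> minor_of H (delete_vertex G v) \<Longrightarrow> minor_of H G"
| minor_contract_edge: "e \<in> medges G \<Longrightarrow> mends G e = {u, v} \<Longrightarrow> u \<noteq> v \<Longrightarrow>
    minor_of H (contract_edge G e u v) \<Longrightarrow> minor_of H G"

definition isomorphic_multigraphs ::
  "('v, 'e) multigraph \<Rightarrow> ('w, 'f) multigraph \<Rightarrow> bool" where
  "isomorphic_multigraphs G H \<longleftrightarrow> (\<exists>f g. bij_betw f (mverts G) (mverts H) \<and>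
     bij_betw g (medges G) (medges H) \<and> (\<forall>e\<in>medges G. mends H (g e) = f ` mends G e))"

definition has_minor :: "('v, 'e) multigraph \<Rightarrow> ('w, 'f) multigraph \<Rightarrow> bool" where
  "has_minor G H \<longleftrightarrow> (\<exists>G'. minor_of G' G \<and> isomorphic_multigraphs G' H)"

definition complete_multigraph :: "nat \<Rightarrow> (nat, nat set) multigraph" where
  "complete_multigraph n =
     \<lparr>mverts = {..<n}, medges = {e. e \<subseteq> {..<n} \<and> card e = 2}, mends = (\<lambda>e. e)\<rparr>"

definition series_parallel :: "('v, 'e) multigraph \<Rightarrow> bool" where
  "series_parallel G \<longleftrightarrow> \<not> has_minor G (complete_multigraph 4)"

definition spanning_subgraph :: "('v, 'e) multigraph \<Rightarrow> 'e set \<Rightarrow> ('v, 'e) multigraph" where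
  "spanning_subgraph G T = G\<lparr>medges := T\<rparr>"

definition is_spanning_tree :: "('v, 'e) multigraph \<Rightarrow> 'e set \<Rightarrow> bool" where
  "is_spanning_tree G T \<longleftrightarrow> T \<subseteq> medges G \<and> connected_multigraph (spanning_subgraph G T) \<and>
     (\<nexists>vs es. is_cycle (spanning_subgraph G T) vs es)"

definition num_spanning_trees :: "('v, 'e) multigraph \<Rightarrow> nat" where
  "num_spanning_trees G = card {T. is_spanning_tree G T}"

text \<open>
  An orientation maps each edge to the pair of its tail and its head. Values outside the edge set
  are fixed by the extensional function space, so that orientations can be counted by \<^const>\<open>card\<close>.
  A loop gets a single direction here; the usual convention of two directions per loop would
  change the number of totally cyclic orientations only for graphs that have loops.
\<close>

definition orientations :: "('v, 'e) multigraph \<Rightarrow> ('e \<Rightarrow> 'v \<times> 'v) set" where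
  "orientations G = (\<Pi>\<^sub>E e\<in>medges G. {(u, v). mends G e = {u, v}})"

definition oriented :: "('v, 'e) multigraph \<Rightarrow> ('e \<Rightarrow> 'v \<times> 'v) \<Rightarrow> ('v, 'e) pre_digraph" where
  "oriented G \<omega> =
     \<lparr>verts = mverts G, arcs = medges G, tail = (\<lambda>e. fst (\<omega> e)), head = (\<lambda>e. snd (\<omega> e))\<rparr>"

definition acyclic_orientation :: "('v, 'e) multigraph \<Rightarrow> ('e \<Rightarrow> 'v \<times> 'v) \<Rightarrow> bool" where
  "acyclic_orientation G \<omega> \<longleftrightarrow> \<omega> \<in> orientations G \<and> (\<nexists>c. pre_digraph.cycle (oriented G \<omega>) c)"

definition totally_cyclic_orientation :: "('v, 'e) multigraph \<Rightarrow> ('e \<Rightarrow> 'v \<times> 'v) \<Rightarrow> bool" where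
  "totally_cyclic_orientation G \<omega> \<longleftrightarrow> \<omega> \<in> orientations G \<and>
     (\<forall>e\<in>medges G. \<exists>c. pre_digraph.cycle (oriented G \<omega>) c \<and> e \<in> set c)"

definition num_acyclic_orientations :: "('v, 'e) multigraph \<Rightarrow> nat" where
  "num_acyclic_orientations G = card {\<omega>. acyclic_orientation G \<omega>}"

definition num_totally_cyclic_orientations :: "('v, 'e) multigraph \<Rightarrow> nat" where
  "num_totally_cyclic_orientations G = card {\<omega>. totally_cyclic_orientation G \<omega>}"

end

theory Submission
  imports Defs
begin

text \<open>
  All three counts satisfy deletion--contraction, so replacing an edge by a two-terminal network
  acts on them linearly, and a network may be treated as a label on a single edge. As long as a
  series-parallel graph without loops and bridges has edges, two of them are in parallel or in
  series, and these can be merged into one edge carrying the parallel or series composition of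
  their labels. Starting from unlabelled edges, one stays within seven labels: whenever the
  composition of two of them is none of the seven, the inequality for it follows by Cauchy--Schwarz
  from the inequalities obtained by placing two of the seven labels on the merged edge, and those
  hold by induction on the number of edges.

  That two parallel or two series edges exist is Dirac's theorem: otherwise the graph is simple of
  minimum degree at least three and has a $K_4$ minor.
\<close>

section \<open>Rank functions and subset expansions\<close>

text \<open>The obstacle is that deleting and contracting an edge does not control its doubling. If
  all three counts of both minors equal 1, the inequality holds for the two minors and, as
  \<open>4 \<le> 4\<close>, for a single edge, but a doubled edge would give
  \<open>9 \<le> 8\<close>. So the instance with \<open>dipole2\<close> on the edge must be a
  hypothesis of its own, and the induction has to run over graphs with arbitrary basic labels. There
  is no room for cruder estimates either: a digon of plain edges gives the equality
  \<open>2 * 2 = 2\<^sup>2\<close>. The seven labels are closed under planar duality, so series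
  compositions reduce to parallel ones. Minors remain pairs of edge sets inside one fixed graph, so
  that excluding a K4 minor of that graph makes all of them reducible. At the end one-sided
  comparisons suffice: the expansions bound the number of spanning trees from above and the numbers
  of orientations from below.\<close>

locale matroid_rank =
  fixes r :: "'e set \<Rightarrow> nat"
  assumes rank_insert: "r (insert e A) = r A \<or> r (insert e A) = Suc (r A)"
    and rank_insert_mono: "A \<subseteq> B \<Longrightarrow> r (insert e A) = r A \<Longrightarrow> r (insert e B) = r B"
begin

text \<open>Membership in the closure. With \<open>C\<close> contracted, \<open>spanned e C\<close>
  says that \<open>e\<close> is a loop, and for \<open>e\<close> outside \<open>E\<close> the
  negation of \<open>spanned e (E \<union> C)\<close> says that \<open>e\<close> is a bridge of
  \<open>insert e E\<close>.\<close>

definition spanned :: "'e \<Rightarrow> 'e set \<Rightarrow> bool" where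
  "spanned e A \<longleftrightarrow> r (insert e A) = r A"

lemma spanned_mono: "spanned e A \<Longrightarrow> A \<subseteq> B \<Longrightarrow> spanned e B"
  unfolding spanned_def by (rule rank_insert_mono)

lemma rank_le_insert: "r A \<le> r (insert e A)"
  using rank_insert[of e A] by linarith

lemma not_spanned: "\<not> spanned e A \<longleftrightarrow> r (insert e A) = Suc (r A)"
  using rank_insert[of e A] by (auto simp: spanned_def)

text \<open>MacLane-Steinitz exchange: the sets \<open>insert e A\<close>, \<open>insert f A\<close>
  and \<open>insert e (insert f A)\<close> all have rank \<open>Suc (r A)\<close>.\<close>

lemma spanned_exchange:
  assumes "spanned f (insert e A)" "\<not> spanned f A"
  shows "spanned e (insert f A)"
  using assms rank_insert[of e A] rank_insert[of f A] rank_le_insert[of "insert f A" e]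
  by (auto simp: spanned_def insert_commute)

lemma spanned_trans:
  assumes "spanned e A" "spanned f (insert e A)"
  shows "spanned f A"
  using assms rank_le_insert[of "insert f A" e] rank_le_insert[of A f]
  by (auto simp: spanned_def insert_commute)

lemma rank_Un_mono: "finite B \<Longrightarrow> r A \<le> r (A \<union> B)"
proof (induction B rule: finite_induct)
  case (insert e B)
  then show ?case using rank_le_insert[of "A \<union> B" e] by simp
qed simp

lemma rank_Un_le: "finite B \<Longrightarrow> r (A \<union> B) \<le> card B + r A"
proof (induction B rule: finite_induct)
  case (insert e B)
  then show ?case using rank_insert[of e "A \<union> B"] by auto
qed simp

lemma rank_Un_spanned: "finite B \<Longrightarrow> (\<And>e. e \<in> B \<Longrightarrow> spanned e A) \<Longrightarrow> r (A \<union> B) = r A"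
proof (induction B rule: finite_induct)
  case (insert e B)
  then show ?case using spanned_mono[of e A "A \<union> B"] by (simp add: spanned_def)
qed simp

text \<open>
  Here and below a pair \<open>E\<close>, \<open>C\<close> stands for the minor with edge set \<open>E\<close> in which the edges \<open>C\<close> have
  been contracted; in Tutte's variables \<open>x\<close> and \<open>y\<close> are shifted by one.
\<close>

definition expansion ::
    "real \<Rightarrow> real \<Rightarrow> ('e \<Rightarrow> real) \<Rightarrow> ('e \<Rightarrow> real) \<Rightarrow> 'e set \<Rightarrow> 'e set \<Rightarrow> real" where
  "expansion x y u v E C = (\<Sum>A\<in>Pow E. prod u A * prod v (E - A) *
     x ^ (r (E \<union> C) - r (A \<union> C)) * y ^ (card A + r C - r (A \<union> C)))"

lemma expansion_empty: "expansion x y u v {} C = 1"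
  by (simp add: expansion_def)

lemma expansion_cong:
  assumes "\<And>e. e \<in> E \<Longrightarrow> u e = u' e" "\<And>e. e \<in> E \<Longrightarrow> v e = v' e"
  shows "expansion x y u v E C = expansion x y u' v' E C"
proof -
  have "prod u A = prod u' A" "prod v (E - A) = prod v' (E - A)" if "A \<in> Pow E" for A
    using that assms by (auto intro!: prod.cong)
  then show ?thesis unfolding expansion_def by (auto intro!: sum.cong)
qed

text \<open>Subsets avoiding \<open>e\<close> belong to the deletion, those containing it to the
  contraction. The exponents shift exactly when \<open>e\<close> is a bridge or a loop, which gives
  the factors \<open>x\<close> and \<open>y\<close>.\<close>

lemma expansion_insert:
  assumes "finite E" "e \<notin> E"
  shows "expansion x y u v (insert e E) C =
     v e * (if spanned e (E \<union> C) then 1 else x) * expansion x y u v E C +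
     u e * (if spanned e C then y else 1) * expansion x y u v E (insert e C)"
proof -
  let ?t = "\<lambda>A. prod u A * prod v (insert e E - A) *
     x ^ (r (insert e E \<union> C) - r (A \<union> C)) * y ^ (card A + r C - r (A \<union> C))"
  have inj: "inj_on (insert e) (Pow E)"
    using assms(2) by (auto simp: inj_on_def)
  have "expansion x y u v (insert e E) C = sum ?t (Pow E \<union> insert e ` Pow E)"
    by (simp add: expansion_def Pow_insert)
  also have "\<dots> = sum ?t (Pow E) + sum ?t (insert e ` Pow E)"
    using assms by (intro sum.union_disjoint) auto
  also have "sum ?t (insert e ` Pow E) = (\<Sum>A\<in>Pow E. ?t (insert e A))"
    by (simp add: sum.reindex[OF inj])
  also have "sum ?t (Pow E) =
      v e * (if spanned e (E \<union> C) then 1 else x) * expansion x y u v E C"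
    unfolding expansion_def sum_distrib_left
  proof (rule sum.cong)
    fix A assume A: "A \<in> Pow E"
    then have fA: "finite A" "finite (E - A)" "e \<notin> A" using assms finite_subset by auto
    have ie: "insert e E - A = insert e (E - A)" using fA by auto
    \<comment> \<open>Excludes truncated subtraction in the exponent of \<open>x\<close>; the bound
      \<open>le\<close> of the second half does the same for \<open>y\<close>.\<close>
    have le: "r (A \<union> C) \<le> r (E \<union> C)"
      using rank_Un_mono[of E "A \<union> C"] assms(1) A by (simp add: Un_absorb1 sup.assoc sup_commute)
        (metis Un_absorb2 sup.assoc sup.commute)
    show "?t A = v e * (if spanned e (E \<union> C) then 1 else x) * (prod u A * prod v (E - A) *
       x ^ (r (E \<union> C) - r (A \<union> C)) * y ^ (card A + r C - r (A \<union> C)))"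
      using le fA assms(2) rank_insert[of e "E \<union> C"]
      by (cases "spanned e (E \<union> C)") (auto simp: ie spanned_def Suc_diff_le)
  qed simp
  also have "(\<Sum>A\<in>Pow E. ?t (insert e A)) =
      u e * (if spanned e C then y else 1) * expansion x y u v E (insert e C)"
    unfolding expansion_def sum_distrib_left
  proof (rule sum.cong)
    fix A assume A: "A \<in> Pow E"
    then have fA: "finite A" "e \<notin> A" using assms finite_subset by auto
    have ie: "insert e E - insert e A = E - A" using assms(2) by auto
    have le: "r (A \<union> insert e C) \<le> card A + r (insert e C)"
      using rank_Un_le[OF fA(1), of "insert e C"] by (simp add: Un_commute)
    show "?t (insert e A) = u e * (if spanned e C then y else 1) * (prod u A * prod v (E - A) *
       x ^ (r (E \<union> insert e C) - r (A \<union> insert e C)) *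
       y ^ (card A + r (insert e C) - r (A \<union> insert e C)))"
      using le fA rank_insert[of e C]
      by (cases "spanned e C") (auto simp: ie spanned_def Suc_diff_le)
  qed simp
  finally show ?thesis .
qed

lemma expansion_contract_loop:
  assumes "spanned f C"
  shows "expansion x y u v E (insert f C) = expansion x y u v E C"
proof -
  have "r (insert f (A \<union> C)) = r (A \<union> C)" for A
    using spanned_mono[OF assms, of "A \<union> C"] by (simp add: spanned_def)
  then show ?thesis using assms by (simp add: expansion_def spanned_def)
qed

text \<open>Contracting a bridge raises every rank in the exponents by one, so the differences are
  unchanged.\<close>

lemma expansion_contract_bridge:
  assumes "\<not> spanned f (E \<union> C)"
  shows "expansion x y u v E (insert f C) = expansion x y u v E C"
proof -
  have "r (insert f (A \<union> C)) = Suc (r (A \<union> C))" if "A \<in> Pow E" for A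
    using spanned_mono[of f "A \<union> C" "E \<union> C"] assms that not_spanned[of f "A \<union> C"] by auto
  moreover have "r (insert f C) = Suc (r C)"
    using spanned_mono[of f C "E \<union> C"] assms not_spanned[of f C] by auto
  ultimately show ?thesis using assms by (simp add: expansion_def not_spanned)
qed

lemma expansion_contract_parallel:
  assumes "spanned f (insert e C)" "spanned e (insert f C)"
  shows "expansion x y u v E (insert f C) = expansion x y u v E (insert e C)"
  using expansion_contract_loop[OF assms(1), of x y u v E]
    expansion_contract_loop[OF assms(2), of x y u v E] by (simp add: insert_commute)

text \<open>Once one of the two edges is contracted the other is a loop, so all terms contracting at
  least one of them coincide. The last assumption keeps \<open>e\<close> from being a bridge after
  \<open>f\<close> is deleted.\<close>

lemma expansion_parallel:
  assumes "finite N" "e \<notin> N" "f \<notin> N" "e \<noteq> f"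
    and "\<not> spanned e C" "\<not> spanned f C" "spanned f (insert e C)"
    and "spanned e (N \<union> C)"
  shows "expansion x y u v (insert e (insert f N)) C =
    v e * v f * expansion x y u v N C +
    (v e * u f + u e * v f + y * u e * u f) * expansion x y u v N (insert e C)"
proof -
  have 1: "spanned e (insert f C)" using spanned_exchange[OF assms(7,6)] .
  have 2: "spanned f (N \<union> C)"
    using spanned_trans[OF assms(8), of f] spanned_mono[OF assms(7), of "insert e (N \<union> C)"] by auto
  show ?thesis
    using assms 1 2 spanned_mono[OF assms(7), of "insert e (N \<union> C)"]
      spanned_mono[OF assms(8), of "insert f (N \<union> C)"]
      expansion_contract_parallel[OF assms(7) 1] expansion_contract_loop[OF assms(7)]
    by (auto simp: expansion_insert algebra_simps insert_commute)
qed

text \<open>Dually, once one edge is deleted the other is a bridge, so all terms deleting at least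
  one of them coincide. The merged edge \<open>e\<close> therefore lives in the minor with
  \<open>f\<close> contracted.\<close>

lemma expansion_series:
  assumes "finite N" "e \<notin> N" "f \<notin> N" "e \<noteq> f"
    and "spanned e (insert f (N \<union> C))" "\<not> spanned e (N \<union> C)" "\<not> spanned f (N \<union> C)"
    and "\<not> spanned e C" "\<not> spanned f (insert e C)"
  shows "expansion x y u v (insert e (insert f N)) C =
    u e * u f * expansion x y u v N (insert e (insert f C)) +
    (v e * u f + u e * v f + x * v e * v f) * expansion x y u v N (insert f C)"
proof -
  have 1: "spanned f (insert e (N \<union> C))" using spanned_exchange[OF assms(5,6)] .
  have "\<not> spanned f C" using assms(7) spanned_mono by blast
  then show ?thesis
    using assms 1 expansion_contract_bridge[OF assms(6)] expansion_contract_bridge[OF assms(7)]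
    by (auto simp: expansion_insert algebra_simps insert_commute)
qed

text \<open>The parallel edges \<open>e\<close> and \<open>f\<close> also form a cut here, so the
  expansion of a two-edge cycle splits off as a factor.\<close>

lemma expansion_digon:
  assumes "finite N" "e \<notin> N" "f \<notin> N" "e \<noteq> f"
    and "\<not> spanned e C" "\<not> spanned f C" "spanned f (insert e C)"
    and "\<not> spanned e (N \<union> C)"
  shows "expansion x y u v (insert e (insert f N)) C =
    (x * v e * v f + v e * u f + u e * v f + y * u e * u f) * expansion x y u v N (insert e C)"
proof -
  have 1: "spanned e (insert f C)" using spanned_exchange[OF assms(7,6)] .
  have 2: "spanned e (insert f (N \<union> C))"
    using spanned_mono[OF 1, of "insert f (N \<union> C)"] by auto
  have 3: "\<not> spanned f (N \<union> C)"
    using spanned_trans[of f "N \<union> C" e] 2 assms(8) by blast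
  show ?thesis
    using assms 1 2 3 spanned_mono[OF assms(7), of "insert e (N \<union> C)"]
      expansion_contract_parallel[OF assms(7) 1] expansion_contract_loop[OF assms(7)]
      expansion_contract_bridge[OF assms(8)]
    by (auto simp: expansion_insert algebra_simps insert_commute)
qed

end

section \<open>Networks\<close>

text \<open>
  A two-terminal network, regarded as an edge label, is recorded by the weights that it
  contributes to the three counts when the edge is deleted or contracted. For acyclic orientations
  of the network, \<open>con_ac\<close> counts those with a directed path from the first to the second
  terminal and \<open>del_ac\<close> those without a directed path in the opposite direction. The pair
  \<open>con_tc\<close>, \<open>del_tc\<close> is its counterpart in the planar dual, \<open>con_tr\<close> counts the spanning trees
  and \<open>del_tr\<close> the spanning forests with two components that separate the terminals.
\<close>

datatype network = Network (del_ac: real) (con_ac: real) (con_tc: real) (del_tc: real)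
  (con_tr: real) (del_tr: real)

text \<open>These are the coefficients in \<open>expansion_parallel\<close> for
  \<open>(x, y)\<close> equal to \<open>(1, -1)\<close>, \<open>(-1, 1)\<close> and
  \<open>(0, 0)\<close>.\<close>

definition parallel :: "network \<Rightarrow> network \<Rightarrow> network" where
  "parallel m n = Network
     (del_ac m * del_ac n)
     (del_ac m * con_ac n + con_ac m * del_ac n - con_ac m * con_ac n)
     (del_tc m * con_tc n + con_tc m * del_tc n + con_tc m * con_tc n)
     (del_tc m * del_tc n)
     (del_tr m * con_tr n + con_tr m * del_tr n)
     (del_tr m * del_tr n)"

definition dual :: "network \<Rightarrow> network" where
  "dual n = Network (con_tc n) (del_tc n) (del_ac n) (con_ac n) (del_tr n) (con_tr n)"

definition series :: "network \<Rightarrow> network \<Rightarrow> network" where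
  "series m n = dual (parallel (dual m) (dual n))"

text \<open>
  \<open>path22\<close> consists of two paths of length two in parallel, \<open>dipole22\<close> of two double edges in
  series.
\<close>

definition "edge = Network 1 1 1 1 1 1"
definition "dipole2 = Network 1 1 3 1 2 1"
definition "dipole3 = Network 1 1 7 1 3 1"
definition "path2 = Network 3 1 1 1 1 2"
definition "path3 = Network 7 1 1 1 1 3"
definition "path22 = Network 9 5 3 1 4 4"
definition "dipole22 = Network 3 1 9 5 4 4"

definition basic :: "network set" where
  "basic = {edge, dipole2, dipole3, path2, path3, path22, dipole22}"

lemma basic_members: "edge \<in> basic" "dipole2 \<in> basic" "dipole3 \<in> basic"
  "path2 \<in> basic" "path3 \<in> basic" "path22 \<in> basic" "dipole22 \<in> basic"
  by (simp_all add: basic_def)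

lemmas network_simps = parallel_def dual_def edge_def dipole2_def dipole3_def path2_def
  path3_def path22_def dipole22_def

lemma parallel_commute: "parallel m n = parallel n m"
  by (simp add: parallel_def algebra_simps)

lemma dual_basic: "n \<in> basic \<Longrightarrow> dual n \<in> basic"
  unfolding basic_def by (elim insertE emptyE; simp add: network_simps)

lemma basic_nonneg:
  assumes "n \<in> basic"
  shows "0 \<le> con_ac n" "con_ac n \<le> del_ac n" "0 \<le> del_tc n" "del_tc n \<le> con_tc n"
    "0 \<le> con_tr n" "0 \<le> del_tr n"
  using assms unfolding basic_def
  by (elim insertE emptyE; simp add: network_simps)+

text \<open>
  The arguments stand for the values of the three counts when the edge carrying the label \<open>n\<close>
  is deleted (index 1) or contracted (index 2).
\<close>

definition admits :: "real \<Rightarrow> real \<Rightarrow> real \<Rightarrow> real \<Rightarrow> real \<Rightarrow> real \<Rightarrow> network \<Rightarrow> bool" where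
  "admits A1 A2 B1 B2 T1 T2 n \<longleftrightarrow> (del_tr n * T1 + con_tr n * T2)\<^sup>2
     \<le> (del_ac n * A1 + con_ac n * A2) * (del_tc n * B1 + con_tc n * B2)"

definition implied :: "network \<Rightarrow> bool" where
  "implied n \<longleftrightarrow> (\<forall>A1 A2 B1 B2 T1 T2. 0 \<le> A2 \<longrightarrow> A2 \<le> A1 \<longrightarrow> 0 \<le> B1 \<longrightarrow> B1 \<le> B2 \<longrightarrow>
     0 \<le> T1 \<longrightarrow> 0 \<le> T2 \<longrightarrow> (\<forall>m\<in>basic. admits A1 A2 B1 B2 T1 T2 m) \<longrightarrow>
     admits A1 A2 B1 B2 T1 T2 n)"

lemma admits_dual: "admits A1 A2 B1 B2 T1 T2 (dual n) = admits B2 B1 A2 A1 T2 T1 n"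
  by (simp add: admits_def dual_def algebra_simps)

lemma implied_dual: "implied n \<Longrightarrow> implied (dual n)"
  unfolding implied_def admits_dual
  by (metis admits_dual dual_basic)

text \<open>Superadditivity of \<open>sqrt (a * b)\<close>, written without roots: the cross term
  \<open>2 * s * t\<close> is bounded by the arithmetic-geometric mean inequality for
  \<open>a * b'\<close> and \<open>a' * b\<close>.\<close>

lemma weighted_Cauchy_Schwarz:
  fixes a b s t :: real
  assumes "s\<^sup>2 \<le> a * b" "t\<^sup>2 \<le> a' * b'" "0 \<le> a" "0 \<le> b" "0 \<le> a'" "0 \<le> b'"
  shows "(s + t)\<^sup>2 \<le> (a + a') * (b + b')"
proof -
  have "(s * t)\<^sup>2 \<le> (a * b) * (a' * b')"
    unfolding power_mult_distrib using assms by (intro mult_mono) simp_all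
  moreover have "4 * ((a * b) * (a' * b')) \<le> (a * b' + a' * b)\<^sup>2"
    using zero_le_power2[of "a * b' - a' * b"] by (simp add: power2_eq_square algebra_simps)
  ultimately have "(2 * s * t)\<^sup>2 \<le> (a * b' + a' * b)\<^sup>2"
    by (simp add: power_mult_distrib)
  then have "2 * s * t \<le> a * b' + a' * b"
    by (rule power2_le_imp_le) (simp add: assms(3-6))
  moreover have "(s + t)\<^sup>2 = s\<^sup>2 + t\<^sup>2 + 2 * s * t" by (rule power2_sum)
  moreover have "(a + a') * (b + b') = a * b + a' * b' + (a * b' + a' * b)"
    by (simp add: algebra_simps)
  ultimately show ?thesis using assms(1,2) by linarith
qed

text \<open>The cone \<open>0 \<le> A2 \<le> A1\<close> is generated by \<open>(1, 0)\<close> and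
  \<open>(1, 1)\<close>, and the last two assumptions compare the two linear forms at these points.
  Hence the conditions \<open>ac\<close> and \<open>tc\<close> of \<open>impliedI\<close> come in
  pairs.\<close>

lemma dominated_combination:
  fixes A1 A2 :: real
  assumes "0 \<le> A2" "A2 \<le> A1" "p \<le> c" "p + q \<le> c + d"
  shows "p * A1 + q * A2 \<le> c * A1 + d * A2"
proof -
  have "0 \<le> (c - p) * (A1 - A2) + (c + d - p - q) * A2"
    using assms by simp
  then show ?thesis by (simp add: algebra_simps)
qed

text \<open>
  The inequality for \<open>n\<close> follows by Cauchy--Schwarz from those for two labels \<open>m\<close> and \<open>m'\<close>,
  scaled by \<open>c\<close>, \<open>c'\<close> in the acyclic and by \<open>d\<close>, \<open>d'\<close> in the totally cyclic factor. The
  multipliers used below were found by a numerical search.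
\<close>

lemma impliedI:
  assumes "m \<in> basic" "m' \<in> basic"
    and nonneg: "0 \<le> c" "0 \<le> d" "0 \<le> k" "0 \<le> c'" "0 \<le> d'" "0 \<le> k'"
    and k: "k\<^sup>2 \<le> c * d" "k'\<^sup>2 \<le> c' * d'"
    and ac: "c * del_ac m + c' * del_ac m' \<le> del_ac n"
      "c * (del_ac m + con_ac m) + c' * (del_ac m' + con_ac m') \<le> del_ac n + con_ac n"
    and tc: "d * con_tc m + d' * con_tc m' \<le> con_tc n"
      "d * (con_tc m + del_tc m) + d' * (con_tc m' + del_tc m') \<le> con_tc n + del_tc n"
    and tr: "0 \<le> del_tr n" "0 \<le> con_tr n"
      "del_tr n \<le> k * del_tr m + k' * del_tr m'" "con_tr n \<le> k * con_tr m + k' * con_tr m'"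
  shows "implied n"
  unfolding implied_def
proof (intro allI impI)
  fix A1 A2 B1 B2 T1 T2 :: real
  assume A: "0 \<le> A2" "A2 \<le> A1" and B: "0 \<le> B1" "B1 \<le> B2" and T: "0 \<le> T1" "0 \<le> T2"
    and "\<forall>m\<in>basic. admits A1 A2 B1 B2 T1 T2 m"
  then have adm: "admits A1 A2 B1 B2 T1 T2 m" "admits A1 A2 B1 B2 T1 T2 m'"
    using assms by auto
  define a where "a = (\<lambda>n. del_ac n * A1 + con_ac n * A2)"
  define b where "b = (\<lambda>n. del_tc n * B1 + con_tc n * B2)"
  define t where "t = (\<lambda>n. del_tr n * T1 + con_tr n * T2)"
  have pos: "0 \<le> a m" "0 \<le> a m'" "0 \<le> b m" "0 \<le> b m'" "0 \<le> t m" "0 \<le> t m'"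
    unfolding a_def b_def t_def
    using A B T basic_nonneg[OF assms(1)] basic_nonneg[OF assms(2)] by auto
  have scaled: "(l * t i)\<^sup>2 \<le> (x * a i) * (y * b i)"
    if "l\<^sup>2 \<le> x * y" "(t i)\<^sup>2 \<le> a i * b i" "0 \<le> x" "0 \<le> y" for l x y i
  proof -
    have "l\<^sup>2 * (t i)\<^sup>2 \<le> (x * y) * (a i * b i)"
      using that by (intro mult_mono) auto
    then show ?thesis by (simp add: power_mult_distrib mult_ac)
  qed
  have "t n \<le> k * t m + k' * t m'"
    using mult_right_mono[OF tr(3) T(1)] mult_right_mono[OF tr(4) T(2)]
    by (simp add: t_def algebra_simps)
  moreover have "0 \<le> t n" using tr T by (simp add: t_def)
  ultimately have "(t n)\<^sup>2 \<le> (k * t m + k' * t m')\<^sup>2" by (rule power_mono)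
  also have "\<dots> \<le> (c * a m + c' * a m') * (d * b m + d' * b m')"
    using adm nonneg pos k
    by (intro weighted_Cauchy_Schwarz scaled) (auto simp: admits_def a_def b_def t_def)
  also have "\<dots> \<le> a n * b n"
  proof (rule mult_mono)
    show "c * a m + c' * a m' \<le> a n"
      using dominated_combination[OF A ac(1), of "c * con_ac m + c' * con_ac m'" "con_ac n"] ac(2)
      by (simp add: a_def algebra_simps)
    then show "0 \<le> a n" using nonneg pos by (smt (verit) mult_nonneg_nonneg)
    show "d * b m + d' * b m' \<le> b n"
      using dominated_combination[OF B tc(1), of "d * del_tc m + d' * del_tc m'" "del_tc n"] tc(2)
      by (simp add: b_def algebra_simps)
    show "0 \<le> d * b m + d' * b m'" using nonneg pos by simp
  qed
  finally show "admits A1 A2 B1 B2 T1 T2 n"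
    by (simp add: admits_def a_def b_def t_def)
qed

text \<open>These are the 28 unordered pairs of basic labels except for three whose composition is
  basic again (see \<open>basic_parallel\<close>). The six numbers are
  \<open>c d k c' d' k'\<close>; a leading triple of zeros means that the second label alone gives
  the bound.\<close>

lemma implied_parallel:
  shows
    "implied (parallel dipole2 dipole2)" and
    "implied (parallel dipole3 edge)" and
    "implied (parallel dipole3 dipole2)" and
    "implied (parallel dipole3 dipole3)" and
    "implied (parallel path2 edge)" and
    "implied (parallel path2 dipole2)" and
    "implied (parallel path2 dipole3)" and
    "implied (parallel path3 edge)" and
    "implied (parallel path3 dipole2)" and
    "implied (parallel path3 dipole3)" and
    "implied (parallel path3 path2)" and
    "implied (parallel path3 path3)" and
    "implied (parallel path22 edge)" and
    "implied (parallel path22 dipole2)" and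
    "implied (parallel path22 dipole3)" and
    "implied (parallel path22 path2)" and
    "implied (parallel path22 path3)" and
    "implied (parallel path22 path22)" and
    "implied (parallel dipole22 edge)" and
    "implied (parallel dipole22 dipole2)" and
    "implied (parallel dipole22 dipole3)" and
    "implied (parallel dipole22 path2)" and
    "implied (parallel dipole22 path3)" and
    "implied (parallel dipole22 path22)" and
    "implied (parallel dipole22 dipole22)"
  apply (rule impliedI[of edge dipole2 "0" "0" "0" "1" "4" "2"];
    (rule basic_members)?; simp add: network_simps power2_eq_square)
  apply (rule impliedI[of edge dipole2 "0" "0" "0" "1" "4" "2"];
    (rule basic_members)?; simp add: network_simps power2_eq_square)
  apply (rule impliedI[of edge dipole3 "0" "0" "0" "1" "4" "2"];
    (rule basic_members)?; simp add: network_simps power2_eq_square)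
  apply (rule impliedI[of edge dipole2 "0" "0" "0" "1" "16" "4"];
    (rule basic_members)?; simp add: network_simps power2_eq_square)
  apply (rule impliedI[of edge dipole2 "1" "1" "1" "2" "1/2" "1"];
    (rule basic_members)?; simp add: network_simps power2_eq_square)
  apply (rule impliedI[of dipole2 dipole3 "1" "1" "1" "2" "1/2" "1"];
    (rule basic_members)?; simp add: network_simps power2_eq_square)
  apply (rule impliedI[of dipole2 dipole3 "2" "2" "2" "1" "1" "1"];
    (rule basic_members)?; simp add: network_simps power2_eq_square)
  apply (rule impliedI[of edge dipole2 "5/2" "1" "3/2" "9/2" "1/2" "3/2"];
    (rule basic_members)?; simp add: network_simps power2_eq_square)
  apply (rule impliedI[of edge dipole2 "0" "0" "0" "7" "2" "7/2"];
    (rule basic_members)?; simp add: network_simps power2_eq_square)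
  apply (rule impliedI[of edge dipole2 "0" "0" "0" "7" "4" "5"];
    (rule basic_members)?; simp add: network_simps power2_eq_square)
  apply (rule impliedI[of edge path2 "11" "3/2" "4" "2" "1/2" "1"];
    (rule basic_members)?; simp add: network_simps power2_eq_square)
  apply (rule impliedI[of edge path2 "9" "1" "3" "11" "1" "3"];
    (rule basic_members)?; simp add: network_simps power2_eq_square)
  apply (rule impliedI[of edge dipole2 "0" "0" "0" "9" "2" "4"];
    (rule basic_members)?; simp add: network_simps power2_eq_square)
  apply (rule impliedI[of edge dipole2 "0" "0" "0" "9" "4" "6"];
    (rule basic_members)?; simp add: network_simps power2_eq_square)
  apply (rule impliedI[of edge dipole2 "0" "0" "0" "9" "8" "8"];
    (rule basic_members)?; simp add: network_simps power2_eq_square)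
  apply (rule impliedI[of dipole2 path22 "16" "1" "4" "1" "1" "1"];
    (rule basic_members)?; simp add: network_simps power2_eq_square)
  apply (rule impliedI[of edge dipole2 "25" "2" "7" "26" "1" "5"];
    (rule basic_members)?; simp add: network_simps power2_eq_square)
  apply (rule impliedI[of edge dipole2 "0" "0" "0" "73" "4" "17"];
    (rule basic_members)?; simp add: network_simps power2_eq_square)
  apply (rule impliedI[of edge dipole2 "0" "0" "0" "3" "7" "4"];
    (rule basic_members)?; simp add: network_simps power2_eq_square)
  apply (rule impliedI[of edge dipole2 "0" "0" "0" "3" "14" "6"];
    (rule basic_members)?; simp add: network_simps power2_eq_square)
  apply (rule impliedI[of edge dipole2 "0" "0" "0" "3" "28" "9"];
    (rule basic_members)?; simp add: network_simps power2_eq_square)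
  apply (rule impliedI[of edge dipole2 "3" "6" "4" "4" "4" "4"];
    (rule basic_members)?; simp add: network_simps power2_eq_square)
  apply (rule impliedI[of edge dipole2 "6" "6" "6" "9" "4" "6"];
    (rule basic_members)?; simp add: network_simps power2_eq_square)
  apply (rule impliedI[of edge dipole2 "0" "0" "0" "23" "14" "17"];
    (rule basic_members)?; simp add: network_simps power2_eq_square)
  apply (rule impliedI[of edge dipole2 "0" "0" "0" "7" "49" "18"];
    (rule basic_members)?; simp add: network_simps power2_eq_square)
  done

lemma basic_parallel:
  assumes "m \<in> basic" "n \<in> basic"
  shows "parallel m n \<in> basic \<or> implied (parallel m n)"
proof -
  have comm: "implied (parallel i j) \<Longrightarrow> implied (parallel j i)" for i j
    by (simp add: parallel_commute)
  have "parallel edge edge = dipole2" "parallel dipole2 edge = dipole3"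
    "parallel edge dipole2 = dipole3" "parallel path2 path2 = path22"
    by (simp_all add: network_simps)
  then show ?thesis
    using assms unfolding basic_def
    by (elim insertE emptyE; simp add: implied_parallel implied_parallel[THEN comm])
qed

lemma basic_series:
  assumes "m \<in> basic" "n \<in> basic"
  shows "series m n \<in> basic \<or> implied (series m n)"
  using basic_parallel[of "dual m" "dual n"] assms
  by (auto simp: series_def intro: dual_basic implied_dual)

text \<open>The inequality for the two-edge cycle labelled \<open>m\<close> and \<open>n\<close>.
  When the edge labelled \<open>n\<close> is deleted, the other is a bridge; when it is contracted,
  the other is a loop. The arguments of \<open>admits\<close> are the resulting factors of
  \<open>m\<close>.\<close>

definition digon_inequality :: "network \<Rightarrow> network \<Rightarrow> bool" where
  "digon_inequality m n \<longleftrightarrow> admits (del_ac m + con_ac m) (del_ac m - con_ac m)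
     (con_tc m - del_tc m) (con_tc m + del_tc m) (con_tr m) (del_tr m) n"

lemma basic_digon: "m \<in> basic \<Longrightarrow> n \<in> basic \<Longrightarrow> digon_inequality m n"
  unfolding basic_def
  by (elim insertE emptyE; simp add: digon_inequality_def admits_def network_simps)

section \<open>Labelled counts and the induction over minors\<close>

context matroid_rank
begin

text \<open>In Tutte's own variables, \<open>ac\<close>, \<open>tc\<close> and \<open>tr\<close> are
  weighted versions of the evaluations at (2,0), (0,2) and (1,1).\<close>

definition ac :: "('e \<Rightarrow> network) \<Rightarrow> 'e set \<Rightarrow> 'e set \<Rightarrow> real" where
  "ac w = expansion 1 (- 1) (\<lambda>e. con_ac (w e)) (\<lambda>e. del_ac (w e))"

definition tc :: "('e \<Rightarrow> network) \<Rightarrow> 'e set \<Rightarrow> 'e set \<Rightarrow> real" where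
  "tc w = expansion (- 1) 1 (\<lambda>e. con_tc (w e)) (\<lambda>e. del_tc (w e))"

definition tr :: "('e \<Rightarrow> network) \<Rightarrow> 'e set \<Rightarrow> 'e set \<Rightarrow> real" where
  "tr w = expansion 0 0 (\<lambda>e. con_tr (w e)) (\<lambda>e. del_tr (w e))"

lemma ac_insert:
  assumes "finite E" "e \<notin> E"
  shows "ac w (insert e E) C = (if spanned e C then (del_ac (w e) - con_ac (w e)) * ac w E C
    else del_ac (w e) * ac w E C + con_ac (w e) * ac w E (insert e C))"
  using expansion_contract_loop[of e C]
  by (simp add: ac_def expansion_insert[OF assms] left_diff_distrib)

lemma tc_insert:
  assumes "finite E" "e \<notin> E"
  shows "tc w (insert e E) C = (if spanned e (E \<union> C)
    then del_tc (w e) * tc w E C + con_tc (w e) * tc w E (insert e C)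
    else (con_tc (w e) - del_tc (w e)) * tc w E (insert e C))"
  using expansion_contract_bridge[of e E C]
  by (simp add: tc_def expansion_insert[OF assms] left_diff_distrib)

text \<open>Provides side conditions of \<open>implied\<close>, from
  \<open>0 \<le> con_ac \<le> del_ac\<close> for the labels. The critical case is that contracting
  \<open>f\<close> turns \<open>e\<close> into a loop: only the deletion term is left, with the
  smaller factor \<open>del_ac - con_ac\<close>.\<close>

lemma ac_mono:
  assumes "finite E" "\<And>e. e \<in> E \<Longrightarrow> w e \<in> basic"
  shows "0 \<le> ac w E C" "ac w E (insert f C) \<le> ac w E C"
proof -
  have "(\<forall>C. 0 \<le> ac w E C) \<and> (\<forall>C f. ac w E (insert f C) \<le> ac w E C)"
    using assms
  proof (induction E rule: finite_induct)
    case empty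
    then show ?case by (simp add: ac_def expansion_empty)
  next
    case (insert e E)
    let ?c = "con_ac (w e)" and ?d = "del_ac (w e)"
    have w: "0 \<le> ?c" "?c \<le> ?d" using basic_nonneg insert.prems by simp_all
    have nonneg: "0 \<le> ac w E C" and mono: "ac w E (insert f C) \<le> ac w E C" for C f
      using insert by auto
    have "ac w (insert e E) (insert f C) \<le> ac w (insert e E) C" for C f
    proof -
      consider "spanned e C" | "\<not> spanned e C" "spanned e (insert f C)" |
        "\<not> spanned e (insert f C)" by blast
      then show ?thesis
      proof cases
        case 1
        then show ?thesis
          using spanned_mono[OF 1, of "insert f C"] w mono
          by (auto simp: ac_insert insert.hyps intro!: mult_left_mono)
      next
        case 2
        have "(?d - ?c) * ac w E (insert f C) \<le> ?d * ac w E C"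
          using w nonneg mono by (intro mult_mono) auto
        moreover have "0 \<le> ?c * ac w E (insert e C)" using w nonneg by simp
        ultimately show ?thesis using 2 by (simp add: ac_insert insert.hyps)
      next
        case 3
        then have "\<not> spanned e C" using spanned_mono by blast
        moreover have "ac w E (insert e (insert f C)) \<le> ac w E (insert e C)"
          using mono[of f "insert e C"] by (simp add: insert_commute)
        ultimately show ?thesis
          using 3 w mono by (auto simp: ac_insert insert.hyps intro!: add_mono mult_left_mono)
      qed
    qed
    moreover have "0 \<le> ac w (insert e E) C" for C
      using w nonneg by (simp add: ac_insert insert.hyps)
    ultimately show ?case by blast
  qed
  then show "0 \<le> ac w E C" "ac w E (insert f C) \<le> ac w E C" by auto
qed

text \<open>Dual to \<open>ac_mono\<close>: the critical case is an edge \<open>e\<close> that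
  ceases to be a bridge when \<open>f\<close> is contracted.\<close>

lemma tc_mono:
  assumes "finite E" "\<And>e. e \<in> E \<Longrightarrow> w e \<in> basic"
  shows "0 \<le> tc w E C" "tc w E C \<le> tc w E (insert f C)"
proof -
  have "(\<forall>C. 0 \<le> tc w E C) \<and> (\<forall>C f. tc w E C \<le> tc w E (insert f C))"
    using assms
  proof (induction E rule: finite_induct)
    case empty
    then show ?case by (simp add: tc_def expansion_empty)
  next
    case (insert e E)
    let ?c = "con_tc (w e)" and ?d = "del_tc (w e)"
    have w: "0 \<le> ?d" "?d \<le> ?c" using basic_nonneg insert.prems by simp_all
    have nonneg: "0 \<le> tc w E C" and mono: "tc w E C \<le> tc w E (insert f C)" for C f
      using insert by auto
    have mono': "tc w E (insert e C) \<le> tc w E (insert e (insert f C))" for C f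
      using mono[of "insert e C" f] by (simp add: insert_commute)
    have "tc w (insert e E) C \<le> tc w (insert e E) (insert f C)" for C f
    proof -
      consider "\<not> spanned e (E \<union> insert f C)" |
        "\<not> spanned e (E \<union> C)" "spanned e (E \<union> insert f C)" | "spanned e (E \<union> C)" by blast
      then show ?thesis
      proof cases
        case 1
        then have "\<not> spanned e (E \<union> C)"
          using spanned_mono[of e "E \<union> C" "E \<union> insert f C"] by auto
        then show ?thesis
          using 1 w mono' by (auto simp: tc_insert insert.hyps intro!: mult_left_mono)
      next
        case 2
        have "(?c - ?d) * tc w E (insert e C) \<le> ?c * tc w E (insert e (insert f C))"
          using w nonneg mono' by (intro mult_mono) auto
        moreover have "0 \<le> ?d * tc w E (insert f C)" using w nonneg by simp
        ultimately show ?thesis using 2 by (simp add: tc_insert insert.hyps)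
      next
        case 3
        then have "spanned e (E \<union> insert f C)" by (rule spanned_mono) auto
        then show ?thesis
          using 3 w mono mono' by (auto simp: tc_insert insert.hyps intro!: add_mono mult_left_mono)
      qed
    qed
    moreover have "0 \<le> tc w (insert e E) C" for C
      using w nonneg by (simp add: tc_insert insert.hyps)
    ultimately show ?case by blast
  qed
  then show "0 \<le> tc w E C" "tc w E C \<le> tc w E (insert f C)" by auto
qed

lemma tr_nonneg:
  assumes "\<And>e. e \<in> E \<Longrightarrow> w e \<in> basic"
  shows "0 \<le> tr w E C"
  unfolding tr_def expansion_def
  using assms basic_nonneg(5,6) by (intro sum_nonneg mult_nonneg_nonneg prod_nonneg) auto

definition loopless_in :: "'e set \<Rightarrow> 'e set \<Rightarrow> bool" where
  "loopless_in E C \<longleftrightarrow> (\<forall>e\<in>E. \<not> spanned e C)"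

definition bridgeless_in :: "'e set \<Rightarrow> 'e set \<Rightarrow> bool" where
  "bridgeless_in E C \<longleftrightarrow> (\<forall>e\<in>E. spanned e (E - {e} \<union> C))"

text \<open>In a minor without loops and bridges the first alternative says that \<open>e\<close>
  and \<open>f\<close> are parallel, the second that they form a cut, that is, are in
  series.\<close>

definition reducible :: "'e set \<Rightarrow> 'e set \<Rightarrow> bool" where
  "reducible E C \<longleftrightarrow> (\<exists>e\<in>E. \<exists>f\<in>E. e \<noteq> f \<and>
     (spanned f (insert e C) \<or> \<not> spanned e (E - {e, f} \<union> C)))"

definition inequality :: "('e \<Rightarrow> network) \<Rightarrow> 'e set \<Rightarrow> 'e set \<Rightarrow> bool" where
  "inequality w E C \<longleftrightarrow> (tr w E C)\<^sup>2 \<le> ac w E C * tc w E C"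

definition admits_at :: "('e \<Rightarrow> network) \<Rightarrow> 'e set \<Rightarrow> 'e \<Rightarrow> 'e set \<Rightarrow> network \<Rightarrow> bool" where
  "admits_at w N e C = admits (ac w N C) (ac w N (insert e C)) (tc w N C) (tc w N (insert e C))
     (tr w N C) (tr w N (insert e C))"

lemma inequality_insert:
  assumes "finite N" "e \<notin> N" "\<not> spanned e C" "spanned e (N \<union> C)"
  shows "inequality (w(e := n)) (insert e N) C \<longleftrightarrow> admits_at w N e C n"
proof -
  \<comment> \<open>The weights \<open>\<phi>\<close> and \<open>\<psi>\<close> are left general so
    that one computation serves all three counts.\<close>
  have "expansion x y (\<lambda>g. \<phi> ((w(e := n)) g)) (\<lambda>g. \<psi> ((w(e := n)) g)) (insert e N) C =
      \<psi> n * expansion x y (\<lambda>g. \<phi> (w g)) (\<lambda>g. \<psi> (w g)) N C +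
      \<phi> n * expansion x y (\<lambda>g. \<phi> (w g)) (\<lambda>g. \<psi> (w g)) N (insert e C)" for x y \<phi> \<psi>
  proof -
    have "expansion x y (\<lambda>g. \<phi> ((w(e := n)) g)) (\<lambda>g. \<psi> ((w(e := n)) g)) N C =
        expansion x y (\<lambda>g. \<phi> (w g)) (\<lambda>g. \<psi> (w g)) N C" for C
      using assms(2) by (intro expansion_cong) auto
    then show ?thesis using assms by (simp add: expansion_insert)
  qed
  then show ?thesis
    by (simp add: inequality_def admits_at_def admits_def ac_def tc_def tr_def)
qed

lemma admits_at_implied:
  assumes "finite N" "\<And>g. g \<in> N \<Longrightarrow> w g \<in> basic"
    and "\<And>n. n \<in> basic \<Longrightarrow> admits_at w N e C n" "n \<in> basic \<or> implied n"
  shows "admits_at w N e C n"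
  using assms(4)
proof
  assume "implied n"
  then show ?thesis
    unfolding implied_def admits_at_def
    using assms(3) ac_mono[OF assms(1,2)] tc_mono[OF assms(1,2)] tr_nonneg[OF assms(2)]
    by (auto simp: admits_at_def)
qed (rule assms(3))

lemma inequality_parallel:
  assumes "finite N" "e \<notin> N" "f \<notin> N" "e \<noteq> f"
    and "\<not> spanned e C" "\<not> spanned f C" "spanned f (insert e C)" "spanned e (N \<union> C)"
  shows "inequality w (insert e (insert f N)) C \<longleftrightarrow> admits_at w N e C (parallel (w e) (w f))"
  unfolding inequality_def admits_at_def admits_def ac_def tc_def tr_def
    expansion_parallel[OF assms] parallel_def network.sel
  by (simp add: algebra_simps)

lemma inequality_series:
  assumes "finite N" "e \<notin> N" "f \<notin> N" "e \<noteq> f"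
    and "spanned e (insert f (N \<union> C))" "\<not> spanned e (N \<union> C)" "\<not> spanned f (N \<union> C)"
    and "\<not> spanned e C" "\<not> spanned f (insert e C)"
  shows "inequality w (insert e (insert f N)) C \<longleftrightarrow>
    admits_at w N e (insert f C) (series (w e) (w f))"
  unfolding inequality_def admits_at_def admits_def ac_def tc_def tr_def
    expansion_series[OF assms] series_def dual_def parallel_def network.sel
  by (simp add: algebra_simps)

lemma inequality_digon:
  assumes "finite N" "e \<notin> N" "f \<notin> N" "e \<noteq> f"
    and "\<not> spanned e C" "\<not> spanned f C" "spanned f (insert e C)" "\<not> spanned e (N \<union> C)"
    and basic: "w e \<in> basic" "w f \<in> basic" "\<And>g. g \<in> N \<Longrightarrow> w g \<in> basic"
    and "inequality w N (insert e C)"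
  shows "inequality w (insert e (insert f N)) C"
proof -
  define a b t where "a = del_ac (w f) * (del_ac (w e) + con_ac (w e)) +
      con_ac (w f) * (del_ac (w e) - con_ac (w e))"
    and "b = del_tc (w f) * (con_tc (w e) - del_tc (w e)) +
      con_tc (w f) * (con_tc (w e) + del_tc (w e))"
    and "t = del_tr (w f) * con_tr (w e) + con_tr (w f) * del_tr (w e)"
  have val: "ac w (insert e (insert f N)) C = a * ac w N (insert e C)"
    "tc w (insert e (insert f N)) C = b * tc w N (insert e C)"
    "tr w (insert e (insert f N)) C = t * tr w N (insert e C)"
    unfolding ac_def tc_def tr_def expansion_digon[OF assms(1-8)] a_def b_def t_def
    by (simp_all add: algebra_simps)
  have nonneg: "0 \<le> a" "0 \<le> b" unfolding a_def b_def
    using basic_nonneg[OF basic(1)] basic_nonneg[OF basic(2)] by (auto intro!: add_nonneg_nonneg mult_nonneg_nonneg)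
  have "t\<^sup>2 \<le> a * b"
    using basic_digon[OF basic(1,2)] by (simp add: digon_inequality_def admits_def a_def b_def t_def)
  then have "t\<^sup>2 * (tr w N (insert e C))\<^sup>2 \<le> (a * b) * (ac w N (insert e C) * tc w N (insert e C))"
    using assms(12) nonneg by (intro mult_mono) (auto simp: inequality_def)
  then show ?thesis by (simp add: inequality_def val power_mult_distrib mult_ac)
qed

text \<open>The set \<open>M\<close> confines the reducibility hypothesis to the minors of one
  graph. Contractions and labels vary in the induction: the merged edge keeps the name
  \<open>e\<close>, and since \<open>f\<close> is gone, the induction hypothesis applies with every
  basic label on \<open>e\<close>.\<close>

theorem inequality_of_reducible:
  assumes "finite E" "E \<subseteq> M" "C \<subseteq> M" "loopless_in E C" "bridgeless_in E C"
    and basic: "\<And>e. e \<in> E \<Longrightarrow> w e \<in> basic"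
    and red: "\<And>E C. E \<subseteq> M \<Longrightarrow> C \<subseteq> M \<Longrightarrow> E \<noteq> {} \<Longrightarrow> loopless_in E C \<Longrightarrow> bridgeless_in E C \<Longrightarrow>
      reducible E C"
  shows "inequality w E C"
  using assms(1-6)
proof (induction "card E" arbitrary: E C w rule: less_induct)
  case less
  show ?case
  proof (cases "E = {}")
    case True
    then show ?thesis by (simp add: inequality_def ac_def tc_def tr_def expansion_empty)
  next
    case False
    note loopless = less.prems(4)[unfolded loopless_in_def, rule_format]
      and bridgeless = less.prems(5)[unfolded bridgeless_in_def, rule_format]
    obtain e f where ef: "e \<in> E" "f \<in> E" "e \<noteq> f"
      and cases: "spanned f (insert e C) \<or> \<not> spanned e (E - {e, f} \<union> C)"
      using red[OF less.prems(2,3) False less.prems(4,5)] by (auto simp: reducible_def)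
    define N where "N = E - {e, f}"
    have N: "finite N" "e \<notin> N" "f \<notin> N" "N \<subseteq> M" "E = insert e (insert f N)"
      using ef less.prems(1,2) by (auto simp: N_def)
    have e: "\<not> spanned e C" "spanned e (insert f (N \<union> C))"
      using loopless[OF ef(1)] bridgeless[OF ef(1)] ef(3) N by (auto simp: insert_Diff_if)
    have f: "\<not> spanned f C"
      using loopless[OF ef(2)] by auto
    have bN: "w g \<in> basic" if "g \<in> N" for g using that less.prems(6) N(5) by auto
    have card: "card N < card E" "card (insert e N) < card E"
      using N ef(3) by auto
    \<comment> \<open>If \<open>e\<close> and \<open>f\<close> are parallel and form a cut, the
      merged edge would be a bridge, so the pair is split off as a factor. In the other two cases
      the merged edge is neither a loop nor a bridge.\<close>
    consider (digon) "spanned f (insert e C)" "\<not> spanned e (N \<union> C)"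
      | (parallel) "spanned f (insert e C)" "spanned e (N \<union> C)"
      | (series) "\<not> spanned f (insert e C)" "\<not> spanned e (N \<union> C)"
      using cases N_def by auto
    then show ?thesis
    proof cases
      case digon
      have "loopless_in N (insert e C)"
        unfolding loopless_in_def
      proof (intro ballI notI)
        fix g assume g: "g \<in> N" "spanned g (insert e C)"
        have "\<not> spanned g C" using loopless[of g] g(1) N(5) by auto
        then have "spanned e (insert g C)" using spanned_exchange[OF g(2)] by blast
        then show False using digon(2) spanned_mono[of e "insert g C" "N \<union> C"] g(1) by auto
      qed
      moreover have "bridgeless_in N (insert e C)"
        unfolding bridgeless_in_def
      proof
        fix g assume g: "g \<in> N"
        have "E - {g} \<union> C = insert f (N - {g} \<union> insert e C)" using g N by auto
        then have "spanned g (insert f (N - {g} \<union> insert e C))"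
          using bridgeless[of g] g N(5) by auto
        moreover have "spanned f (N - {g} \<union> insert e C)"
          using digon(1) by (rule spanned_mono) auto
        ultimately show "spanned g (N - {g} \<union> insert e C)" using spanned_trans by blast
      qed
      ultimately have "inequality w N (insert e C)"
        using N ef less.prems(2,3) bN by (intro less.hyps[OF card(1)]) auto
      then show ?thesis
        unfolding N(5) using N(1-3) ef e(1) f digon less.prems(6) bN
        by (intro inequality_digon) auto
    next
      case parallel
      have adm: "admits_at w N e C n" if n: "n \<in> basic" for n
      proof -
        have "bridgeless_in (insert e N) C"
          unfolding bridgeless_in_def
        proof
          fix g assume g: "g \<in> insert e N"
          show "spanned g (insert e N - {g} \<union> C)"
          proof (cases "g = e")
            case True
            then show ?thesis using parallel(2) N(2) by simp
          next
            case False
            then have "E - {g} \<union> C = insert f (insert e N - {g} \<union> C)" using g N by auto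
            then have "spanned g (insert f (insert e N - {g} \<union> C))"
              using bridgeless[of g] g N(5) by auto
            moreover have "spanned f (insert e N - {g} \<union> C)"
              using parallel(1) False by (auto elim!: spanned_mono)
            ultimately show ?thesis using spanned_trans by blast
          qed
        qed
        moreover have "loopless_in (insert e N) C"
          using less.prems(4) N(5) by (auto simp: loopless_in_def)
        ultimately have "inequality (w(e := n)) (insert e N) C"
          using N ef less.prems(2,3) n bN by (intro less.hyps[OF card(2)]) auto
        then show ?thesis using inequality_insert[OF N(1,2) e(1) parallel(2)] by simp
      qed
      have "admits_at w N e C (parallel (w e) (w f))"
        using admits_at_implied[OF N(1) bN adm]
          basic_parallel[OF less.prems(6)[OF ef(1)] less.prems(6)[OF ef(2)]] by blast
      then show ?thesis
        unfolding N(5) using inequality_parallel[OF N(1-3) ef(3) e(1) f parallel] by simp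
    next
      case series
      have f': "\<not> spanned f (N \<union> C)" using spanned_trans[of f "N \<union> C" e] e(2) series(2) by blast
      have e': "\<not> spanned e (insert f C)" using spanned_exchange[of e f C] e(1) series(1) by blast
      have adm: "admits_at w N e (insert f C) n" if n: "n \<in> basic" for n
      proof -
        \<comment> \<open>A new loop \<open>g\<close> would be parallel to \<open>f\<close>, so
          \<open>N \<union> C\<close> would span \<open>f\<close>, although \<open>e\<close> and
          \<open>f\<close> form a cut.\<close>
        have "loopless_in (insert e N) (insert f C)"
          unfolding loopless_in_def
        proof (intro ballI notI)
          fix g assume g: "g \<in> insert e N" "spanned g (insert f C)"
          then have gN: "g \<in> N" using e' by auto
          have "\<not> spanned g C" using loopless[of g] gN N(5) by auto
          then have "spanned f (insert g C)" using spanned_exchange[OF g(2)] by blast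
          then show False using f' spanned_mono[of f "insert g C" "N \<union> C"] gN by auto
        qed
        moreover have "bridgeless_in (insert e N) (insert f C)"
          unfolding bridgeless_in_def
        proof
          fix g assume g: "g \<in> insert e N"
          have "E - {g} \<union> C = insert e N - {g} \<union> insert f C" using g N ef(3) by auto
          then show "spanned g (insert e N - {g} \<union> insert f C)"
            using bridgeless[of g] g N(5) by auto
        qed
        ultimately have "inequality (w(e := n)) (insert e N) (insert f C)"
          using N ef less.prems(2,3) n bN by (intro less.hyps[OF card(2)]) auto
        then show ?thesis using inequality_insert[OF N(1,2) e'] e(2) by simp
      qed
      have "admits_at w N e (insert f C) (series (w e) (w f))"
        using admits_at_implied[OF N(1) bN adm]
          basic_series[OF less.prems(6)[OF ef(1)] less.prems(6)[OF ef(2)]] by blast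
      then show ?thesis
        unfolding N(5) using inequality_series[OF N(1-3) ef(3) e(2) series(2) f' e(1) series(1)]
        by simp
    qed
  qed
qed

end

section \<open>Spanning trees as bases\<close>

context matroid_rank
begin

lemma rank_forest:
  assumes "finite T" "\<And>e. e \<in> T \<Longrightarrow> \<not> spanned e (T - {e})"
  shows "r T = card T + r {}"
  using assms
proof (induction T rule: finite_induct)
  case (insert e T)
  have "\<not> spanned g (T - {g})" if "g \<in> T" for g
    using insert.prems[of g] spanned_mono[of g "T - {g}" "insert e T - {g}"] that by blast
  then have "r T = card T + r {}" using insert.IH by blast
  moreover have "\<not> spanned e T" using insert.prems[of e] insert.hyps(2) by simp
  ultimately show ?case using insert.hyps by (simp add: not_spanned)
qed simp

text \<open>Since \<open>0 ^ 0 = 1\<close>, the powers of zero select exactly the subsets of full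
  rank and nullity zero, the bases.\<close>

lemma tr_unlabelled:
  assumes "finite E"
  shows "tr (\<lambda>_. edge) E {} = card {T. T \<subseteq> E \<and> r T = r E \<and> r T = card T + r {}}"
proof -
  have "tr (\<lambda>_. edge) E {} =
      (\<Sum>T\<in>Pow E. if r T = r E \<and> r T = card T + r {} then 1 else 0)"
    unfolding tr_def expansion_def
  proof (rule sum.cong)
    fix T assume "T \<in> Pow E"
    then have T: "T \<subseteq> E" "finite T" using assms finite_subset by auto
    have "r T \<le> r E" using rank_Un_mono[of E T] assms T by (simp add: Un_absorb1)
    moreover have "r T \<le> card T + r {}" using rank_Un_le[OF T(2), of "{}"] by simp
    ultimately show "(\<Prod>e\<in>T. con_tr edge) * (\<Prod>e\<in>E - T. del_tr edge) *
        0 ^ (r (E \<union> {}) - r (T \<union> {})) * 0 ^ (card T + r {} - r (T \<union> {})) =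
        (if r T = r E \<and> r T = card T + r {} then 1 else (0 :: real))"
      by (auto simp: edge_def power_0_left)
  qed simp
  also have "\<dots> = card {T \<in> Pow E. r T = r E \<and> r T = card T + r {}}"
    using assms by (simp add: sum.inter_filter[symmetric])
  finally show ?thesis by (simp add: Pow_def)
qed

end

section \<open>Orientations\<close>

lemma rtrancl_Un_cases:
  assumes "(a, b) \<in> (R \<union> D)\<^sup>*"
  shows "(a, b) \<in> D\<^sup>* \<or> (\<exists>(x, y)\<in>R. (a, x) \<in> (R \<union> D)\<^sup>* \<and> (y, b) \<in> (R \<union> D)\<^sup>*)"
  using assms
proof (induction rule: rtrancl_induct)
  case (step y z)
  then show ?case by (fastforce intro: rtrancl_into_rtrancl)
qed simp

text \<open>
  In a mixed graph with directed edges \<open>R\<close> and undirected edges \<open>D\<close>, a directed edge lies on a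
  closed walk iff its tail is reachable from its head.
\<close>

definition no_closed_walk :: "'v rel \<Rightarrow> 'v rel \<Rightarrow> bool" where
  "no_closed_walk R D \<longleftrightarrow> (\<forall>(x, y)\<in>R. (y, x) \<notin> (R \<union> D)\<^sup>*)"

definition all_closed_walk :: "'v rel \<Rightarrow> 'v rel \<Rightarrow> bool" where
  "all_closed_walk R D \<longleftrightarrow> (\<forall>(x, y)\<in>R. (y, x) \<in> (R \<union> D)\<^sup>*)"

text \<open>If both directions closed a walk, \<open>s\<close> and \<open>t\<close> would reach each
  other in \<open>R \<union> D\<close>. The walk from \<open>t\<close> to \<open>s\<close> cannot
  stay in \<open>D\<close>, so it contains an arc of \<open>R\<close>, which then lies on a closed
  walk.\<close>

lemma no_closed_walk_insert:
  assumes "no_closed_walk R D" "(t, s) \<notin> D\<^sup>*"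
  shows "no_closed_walk (insert (s, t) R) D \<or> no_closed_walk (insert (t, s) R) D"
proof (rule ccontr)
  assume *: "\<not> ?thesis"
  have reach: "(b, a) \<in> (R \<union> D)\<^sup>*" if not: "\<not> no_closed_walk (insert (a, b) R) D" for a b
  proof -
    obtain x y where xy: "(x, y) \<in> insert (a, b) R" "(y, x) \<in> (insert (a, b) (R \<union> D))\<^sup>*"
      using not by (auto simp: no_closed_walk_def)
    show ?thesis
    proof (cases "(x, y) \<in> R")
      case True
      then have "(y, a) \<in> (R \<union> D)\<^sup>*" "(b, x) \<in> (R \<union> D)\<^sup>*"
        using xy(2) assms(1) by (auto simp: rtrancl_insert no_closed_walk_def)
      moreover have "(x, y) \<in> (R \<union> D)\<^sup>*" using True by auto
      ultimately show ?thesis by (meson rtrancl_trans)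
    qed (use xy in \<open>auto simp: rtrancl_insert\<close>)
  qed
  have st: "(t, s) \<in> (R \<union> D)\<^sup>*" "(s, t) \<in> (R \<union> D)\<^sup>*" using reach * by auto
  obtain x y where xy: "(x, y) \<in> R" "(t, x) \<in> (R \<union> D)\<^sup>*" "(y, s) \<in> (R \<union> D)\<^sup>*"
    using rtrancl_Un_cases[OF st(1)] assms(2) by auto
  have "(y, x) \<in> (R \<union> D)\<^sup>*" using xy st by (meson rtrancl_trans)
  then show False using assms(1) xy(1) by (auto simp: no_closed_walk_def)
qed

text \<open>Making the new arc undirected preserves walks, so only a closed walk through that arc is
  at issue. It returns from \<open>t\<close> to \<open>s\<close> through an arc of \<open>R\<close>,
  as \<open>D\<close> does not lead from \<open>t\<close> to \<open>s\<close>.\<close>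

lemma no_closed_walk_orient:
  assumes "no_closed_walk R (insert (s, t) (insert (t, s) D))" "(t, s) \<notin> D\<^sup>*"
  shows "no_closed_walk (insert (s, t) R) D"
  unfolding no_closed_walk_def
proof (intro ballI, clarify)
  fix x y assume xy: "(x, y) \<in> insert (s, t) R" and yx: "(y, x) \<in> (insert (s, t) R \<union> D)\<^sup>*"
  let ?Q = "(R \<union> insert (s, t) (insert (t, s) D))\<^sup>*"
  have sub: "(insert (s, t) R \<union> D)\<^sup>* \<subseteq> ?Q" "(R \<union> D)\<^sup>* \<subseteq> ?Q"
    by (rule rtrancl_mono; blast)+
  show False
  proof (cases "(x, y) \<in> R")
    case True
    then show ?thesis using assms(1) yx sub by (auto simp: no_closed_walk_def)
  next
    case False
    then have "(t, s) \<in> (R \<union> D)\<^sup>*" using xy yx by (auto simp: rtrancl_insert)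
    then obtain a b where ab: "(a, b) \<in> R" "(t, a) \<in> (R \<union> D)\<^sup>*" "(b, s) \<in> (R \<union> D)\<^sup>*"
      using rtrancl_Un_cases[of t s R D] assms(2) by auto
    have "(b, s) \<in> ?Q" "(s, t) \<in> ?Q" "(t, a) \<in> ?Q" using ab sub by auto
    then have "(b, a) \<in> ?Q" by (meson rtrancl_trans)
    then show False using assms(1) ab(1) by (auto simp: no_closed_walk_def)
  qed
qed

text \<open>Every arc of \<open>R\<close> is reversed by some walk, so vertices joined in the
  underlying undirected graph reach each other.\<close>

lemma all_closed_walk_insert:
  assumes "all_closed_walk R D" "sym D" "(s, t) \<in> (R \<union> R\<inverse> \<union> D)\<^sup>*"
  shows "all_closed_walk (insert (s, t) R) D"
proof -
  have "R \<union> R\<inverse> \<union> D \<subseteq> (R \<union> D)\<^sup>*"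
    using assms(1) by (auto simp: all_closed_walk_def)
  then have "(R \<union> R\<inverse> \<union> D)\<^sup>* \<subseteq> (R \<union> D)\<^sup>*"
    by (intro rtrancl_subset_rtrancl)
  moreover have "(t, s) \<in> (R \<union> R\<inverse> \<union> D)\<^sup>*"
  proof -
    have "sym (R \<union> R\<inverse> \<union> D)" using assms(2) by (auto simp: sym_def)
    then show ?thesis using assms(3) sym_rtrancl symD by metis
  qed
  ultimately have "(t, s) \<in> (R \<union> D)\<^sup>*" by auto
  moreover have "(R \<union> D)\<^sup>* \<subseteq> (insert (s, t) R \<union> D)\<^sup>*" by (rule rtrancl_mono) auto
  ultimately show ?thesis using assms(1) by (auto simp: all_closed_walk_def)
qed

text \<open>If one end reaches the other in \<open>R \<union> D\<close>, the edge is directed so as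
  to close this walk, and the walk replaces the lost direction. If neither did, the set reachable
  from \<open>s\<close> would be closed under backward arcs too and hence contain
  \<open>t\<close>.\<close>

lemma all_closed_walk_orient:
  assumes "all_closed_walk R (insert (s, t) (insert (t, s) D))" "sym D"
    and "(s, t) \<in> (R \<union> R\<inverse> \<union> D)\<^sup>*"
  shows "all_closed_walk (insert (s, t) R) D \<or> all_closed_walk (insert (t, s) R) D"
proof -
  let ?Q = "R \<union> D" and ?Q' = "R \<union> insert (s, t) (insert (t, s) D)"
  have orient: "all_closed_walk (insert (a, b) R) D"
    if "(b, a) \<in> ?Q\<^sup>*" "?Q' \<subseteq> insert (a, b) (insert (b, a) ?Q)" for a b
  proof -
    have Q: "?Q\<^sup>* \<subseteq> (insert (a, b) R \<union> D)\<^sup>*" by (rule rtrancl_mono) auto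
    then have "?Q' \<subseteq> (insert (a, b) R \<union> D)\<^sup>*" using that by blast
    then have "?Q'\<^sup>* \<subseteq> (insert (a, b) R \<union> D)\<^sup>*" by (rule rtrancl_subset_rtrancl)
    then show ?thesis using assms(1) that(1) Q by (auto simp: all_closed_walk_def)
  qed
  have "(t, s) \<in> ?Q\<^sup>* \<or> (s, t) \<in> ?Q\<^sup>*"
  proof (rule ccontr)
    assume no: "\<not> ?thesis"
    have closed: "(s, y) \<in> ?Q\<^sup>*" if x: "(s, x) \<in> ?Q\<^sup>*" and yx: "(y, x) \<in> R" for x y
    proof -
      have xy: "(x, y) \<in> ?Q'\<^sup>*" using assms(1) yx by (auto simp: all_closed_walk_def)
      then have "(x, y) \<in> ?Q\<^sup>* \<or> (x, s) \<in> ?Q\<^sup>* \<or> (x, t) \<in> ?Q\<^sup>*"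
        by (induction rule: converse_rtrancl_induct) (auto intro: converse_rtrancl_into_rtrancl)
      moreover from xy have "(s, y) \<in> ?Q\<^sup>* \<or> (t, y) \<in> ?Q\<^sup>*"
        by (induction rule: rtrancl_induct) (use x in \<open>auto intro: rtrancl_into_rtrancl\<close>)
      moreover have "(y, x) \<in> ?Q\<^sup>*" using yx by auto
      ultimately show ?thesis using no x by (meson rtrancl_trans)
    qed
    have "(s, t) \<in> ?Q\<^sup>*"
      using assms(3)
    proof (induction rule: rtrancl_induct)
      case (step y z)
      then show ?case using closed[of y z] by (auto intro: rtrancl_into_rtrancl)
    qed simp
    then show False using no by simp
  qed
  then show ?thesis using orient[of t s] orient[of s t] by auto
qed

section \<open>The cycle matroid of a graph\<close>

locale edge_ends =
  fixes s t :: "'e \<Rightarrow> 'v" and V :: "'v set"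
  assumes finite_V: "finite V" and ends_in_V: "s e \<noteq> t e \<Longrightarrow> s e \<in> V \<and> t e \<in> V"
begin

definition adj :: "'e set \<Rightarrow> 'v rel" where
  "adj A = (\<lambda>e. (s e, t e)) ` A \<union> (\<lambda>e. (t e, s e)) ` A"

definition conn :: "'e set \<Rightarrow> 'v rel" where
  "conn A = (adj A)\<^sup>*"

lemma adj_insert: "adj (insert e A) = insert (s e, t e) (insert (t e, s e) (adj A))"
  by (auto simp: adj_def)

lemma sym_adj: "sym (adj A)"
  by (auto simp: adj_def sym_def)

lemma conn_sym: "(x, y) \<in> conn A \<Longrightarrow> (y, x) \<in> conn A"
  using sym_adj sym_rtrancl unfolding conn_def by (metis symD)

lemma conn_trans: "(x, y) \<in> conn A \<Longrightarrow> (y, z) \<in> conn A \<Longrightarrow> (x, z) \<in> conn A"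
  unfolding conn_def by (rule rtrancl_trans)

lemma conn_mono: "A \<subseteq> B \<Longrightarrow> conn A \<subseteq> conn B"
  unfolding conn_def adj_def by (rule rtrancl_mono) blast

lemma conn_insert_loop:
  assumes "(s e, t e) \<in> conn A"
  shows "conn (insert e A) = conn A"
proof
  have "adj (insert e A) \<subseteq> conn A"
    using assms conn_sym[OF assms] by (auto simp: adj_insert conn_def)
  then show "conn (insert e A) \<subseteq> conn A"
    unfolding conn_def by (rule rtrancl_subset_rtrancl)
  show "conn A \<subseteq> conn (insert e A)" by (rule conn_mono) auto
qed

lemma conn_insert_iff:
  "(x, y) \<in> conn (insert e A) \<longleftrightarrow> (x, y) \<in> conn A \<or>
     (x, s e) \<in> conn A \<and> (t e, y) \<in> conn A \<or> (x, t e) \<in> conn A \<and> (s e, y) \<in> conn A"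
  (is "?l \<longleftrightarrow> ?r")
proof
  assume ?l
  then show ?r
    unfolding conn_def
  proof (induction rule: rtrancl_induct)
    case (step y z)
    then show ?case
      by (auto simp: adj_insert intro: rtrancl_into_rtrancl)
  qed simp
next
  have e: "(s e, t e) \<in> conn (insert e A)" "(t e, s e) \<in> conn (insert e A)"
    by (auto simp: conn_def adj_insert)
  have sub: "conn A \<subseteq> conn (insert e A)" by (rule conn_mono) auto
  assume ?r
  then show ?l using e sub by (meson conn_trans subsetD)
qed

definition components :: "'e set \<Rightarrow> 'v set set" where
  "components A = (\<lambda>x. conn A `` {x}) ` V"

definition rank :: "'e set \<Rightarrow> nat" where
  "rank A = card V - card (components A)"

lemma conn_class_eq: "(x, y) \<in> conn A \<Longrightarrow> conn A `` {x} = conn A `` {y}"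
  using conn_trans conn_sym by blast

lemma conn_class_eq_iff: "conn A `` {x} = conn A `` {y} \<longleftrightarrow> (x, y) \<in> conn A"
proof
  assume "conn A `` {x} = conn A `` {y}"
  moreover have "y \<in> conn A `` {y}" by (simp add: conn_def)
  ultimately show "(x, y) \<in> conn A" by auto
qed (rule conn_class_eq)

lemma components_insert:
  assumes "(s e, t e) \<notin> conn A"
  defines "a \<equiv> conn A `` {s e}" and "b \<equiv> conn A `` {t e}"
  shows "components (insert e A) = insert (a \<union> b) (components A - {a, b})"
proof -
  have refl: "(x, x) \<in> conn A" for x by (simp add: conn_def)
  have V: "s e \<in> V" "t e \<in> V" using assms(1) ends_in_V[of e] refl by metis+
  have cls: "conn (insert e A) `` {x} =
      (if conn A `` {x} \<in> {a, b} then a \<union> b else conn A `` {x})" for x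
  proof -
    have "conn A `` {x} = a \<longleftrightarrow> (x, s e) \<in> conn A" "conn A `` {x} = b \<longleftrightarrow> (x, t e) \<in> conn A"
      by (simp_all add: a_def b_def conn_class_eq_iff)
    moreover have "conn (insert e A) `` {x} = conn A `` {x} \<union>
        (if (x, s e) \<in> conn A then b else {}) \<union> (if (x, t e) \<in> conn A then a else {})"
      by (auto simp: a_def b_def conn_insert_iff)
    moreover have "\<not> ((x, s e) \<in> conn A \<and> (x, t e) \<in> conn A)"
      using assms(1) conn_sym[of x "s e" A] conn_trans[of "s e" x A "t e"] by blast
    ultimately show ?thesis by auto
  qed
  have ab: "a \<in> components A" "b \<in> components A"
    using V by (auto simp: a_def b_def components_def)
  have "components (insert e A) = (\<lambda>X. if X \<in> {a, b} then a \<union> b else X) ` components A"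
    unfolding components_def image_image by (simp only: cls)
  also have "\<dots> = insert (a \<union> b) (components A - {a, b})" using ab by auto
  finally show ?thesis .
qed

lemma rank_insert_eq:
  "rank (insert e A) = (if (s e, t e) \<in> conn A then rank A else Suc (rank A))"
proof (cases "(s e, t e) \<in> conn A")
  case True
  then show ?thesis by (simp add: rank_def components_def conn_insert_loop)
next
  case False
  let ?a = "conn A `` {s e}" and ?b = "conn A `` {t e}"
  have refl: "(x, x) \<in> conn A" for x by (simp add: conn_def)
  have fin: "finite (components A)"
    using finite_V by (simp add: components_def)
  have le: "card (components A) \<le> card V"
    unfolding components_def using card_image_le[OF finite_V] .
  have V: "s e \<in> V" "t e \<in> V" using False ends_in_V[of e] refl by metis+
  then have ab: "?a \<in> components A" "?b \<in> components A" "?a \<noteq> ?b"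
    using False by (auto simp: components_def conn_class_eq_iff)
  have "?a \<union> ?b \<notin> components A - {?a, ?b}"
  proof
    assume "?a \<union> ?b \<in> components A - {?a, ?b}"
    then obtain x where x: "?a \<union> ?b = conn A `` {x}" "?a \<union> ?b \<noteq> ?a"
      by (auto simp: components_def)
    have "(x, s e) \<in> conn A" using x(1) refl[of "s e"] by blast
    then show False using x conn_class_eq by metis
  qed
  then have "card (components (insert e A)) = Suc (card (components A - {?a, ?b}))"
    using fin by (simp add: components_insert[OF False])
  also have "card (components A - {?a, ?b}) = card (components A) - 2"
    using ab fin by (simp add: card_Diff_subset)
  finally have "Suc (card (components (insert e A))) = card (components A)"
    using ab fin card_mono[of "components A" "{?a, ?b}"] by auto
  then show ?thesis using False le by (simp add: rank_def)
qed

sublocale matroid_rank rank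
proof
  fix e and A B :: "'e set"
  show "rank (insert e A) = rank A \<or> rank (insert e A) = Suc (rank A)"
    by (simp add: rank_insert_eq)
  show "rank (insert e B) = rank B" if "A \<subseteq> B" "rank (insert e A) = rank A"
    using that conn_mono[OF that(1)] by (auto simp: rank_insert_eq split: if_splits)
qed

lemma spanned_iff: "spanned e A \<longleftrightarrow> (s e, t e) \<in> conn A"
  by (simp add: spanned_def rank_insert_eq)

section \<open>Orientations encoded by their sets of reversed edges\<close>

definition dart :: "'e set \<Rightarrow> 'e \<Rightarrow> 'v \<times> 'v" where
  "dart B e = (if e \<in> B then (t e, s e) else (s e, t e))"

definition acyclics :: "'e set \<Rightarrow> 'e set \<Rightarrow> 'e set set" where
  "acyclics E C = {B \<in> Pow E. no_closed_walk (dart B ` E) (adj C)}"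

definition totally_cyclics :: "'e set \<Rightarrow> 'e set \<Rightarrow> 'e set set" where
  "totally_cyclics E C = {B \<in> Pow E. all_closed_walk (dart B ` E) (adj C)}"

lemma dart_insert:
  assumes "e \<notin> E" "B \<subseteq> E"
  shows "dart B ` insert e E = insert (s e, t e) (dart B ` E)"
    "dart (insert e B) ` insert e E = insert (t e, s e) (dart B ` E)"
proof -
  have "dart (insert e B) f = dart B f" if "f \<in> E" for f using assms(1) that by (auto simp: dart_def)
  then show "dart B ` insert e E = insert (s e, t e) (dart B ` E)"
    "dart (insert e B) ` insert e E = insert (t e, s e) (dart B ` E)"
    using assms by (auto simp: dart_def)
qed

text \<open>Inclusion-exclusion: \<open>X\<close> lies in the union and \<open>Y\<close> in the
  intersection of the family of sets that belong to \<open>Z\<close> as they are and the family of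
  those that do so after adding \<open>e\<close>.\<close>

lemma card_reorient:
  assumes "finite E" "e \<notin> E" "X \<union> Y \<subseteq> Pow E"
    and "\<And>B. B \<in> X \<Longrightarrow> B \<in> Z \<or> insert e B \<in> Z" "\<And>B. B \<in> Y \<Longrightarrow> B \<in> Z \<and> insert e B \<in> Z"
    and "Z \<subseteq> Pow (insert e E)"
  shows "card X + card Y \<le> card Z"
proof -
  let ?P = "{B \<in> Pow E. B \<in> Z}" and ?Q = "{B \<in> Pow E. insert e B \<in> Z}"
  have fin: "finite ?P" "finite ?Q" "finite Z"
    using assms(1,6) by (auto intro: finite_subset)
  have "card X + card Y \<le> card (?P \<union> ?Q) + card (?P \<inter> ?Q)"
    using assms(3-5) fin by (intro add_mono card_mono) auto
  also have "\<dots> = card ?P + card ?Q" using card_Un_Int[OF fin(1,2)] by simp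
  also have "card ?Q = card (insert e ` ?Q)"
    using assms(2) by (intro card_image[symmetric]) (auto simp: inj_on_def)
  also have "card ?P + \<dots> = card (?P \<union> insert e ` ?Q)"
    using fin assms(2) by (intro card_Un_disjoint[symmetric]) auto
  also have "\<dots> \<le> card Z" using fin by (intro card_mono) auto
  finally show ?thesis .
qed

text \<open>An acyclic orientation of the deletion extends to \<open>e\<close> in at least one way,
  one of the contraction in both ways.\<close>

lemma card_acyclics_insert:
  assumes "finite E" "e \<notin> E" "\<not> spanned e C"
  shows "card (acyclics E C) + card (acyclics E (insert e C)) \<le> card (acyclics (insert e E) C)"
proof (rule card_reorient[OF assms(1,2)])
  have ts: "(t e, s e) \<notin> (adj C)\<^sup>*" "(s e, t e) \<notin> (adj C)\<^sup>*"
    using assms(3) conn_sym[of "t e" "s e" C] by (auto simp: spanned_iff conn_def)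
  show "B \<in> acyclics (insert e E) C \<or> insert e B \<in> acyclics (insert e E) C"
    if "B \<in> acyclics E C" for B
    using that no_closed_walk_insert[of "dart B ` E" "adj C", OF _ ts(1)] dart_insert[OF assms(2), of B]
    by (auto simp: acyclics_def)
  show "B \<in> acyclics (insert e E) C \<and> insert e B \<in> acyclics (insert e E) C"
    if "B \<in> acyclics E (insert e C)" for B
    using that no_closed_walk_orient[of "dart B ` E" "s e" "t e" "adj C", OF _ ts(1)]
      no_closed_walk_orient[of "dart B ` E" "t e" "s e" "adj C", OF _ ts(2)] dart_insert[OF assms(2), of B]
    by (auto simp: acyclics_def adj_insert insert_commute)
qed (auto simp: acyclics_def)

lemma adj_darts: "dart B ` E \<union> (dart B ` E)\<inverse> \<union> adj C = adj (E \<union> C)"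
  by (force simp: adj_def dart_def)

text \<open>Compared with the acyclic case, deletion and contraction exchange roles.\<close>

lemma card_totally_cyclics_insert:
  assumes "finite E" "e \<notin> E" "spanned e (E \<union> C)"
  shows "card (totally_cyclics E (insert e C)) + card (totally_cyclics E C)
    \<le> card (totally_cyclics (insert e E) C)"
proof (rule card_reorient[OF assms(1,2)])
  have st: "(s e, t e) \<in> (dart B ` E \<union> (dart B ` E)\<inverse> \<union> adj C)\<^sup>*"
    "(t e, s e) \<in> (dart B ` E \<union> (dart B ` E)\<inverse> \<union> adj C)\<^sup>*" for B
    using assms(3) conn_sym[of "s e" "t e" "E \<union> C"] by (auto simp: adj_darts spanned_iff conn_def)
  show "B \<in> totally_cyclics (insert e E) C \<or> insert e B \<in> totally_cyclics (insert e E) C"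
    if "B \<in> totally_cyclics E (insert e C)" for B
    using that all_closed_walk_orient[OF _ sym_adj st(1), of B] dart_insert[OF assms(2), of B]
    by (auto simp: totally_cyclics_def adj_insert)
  show "B \<in> totally_cyclics (insert e E) C \<and> insert e B \<in> totally_cyclics (insert e E) C"
    if "B \<in> totally_cyclics E C" for B
    using that all_closed_walk_insert[OF _ sym_adj st(1), of B]
      all_closed_walk_insert[OF _ sym_adj st(2), of B] dart_insert[OF assms(2), of B]
    by (auto simp: totally_cyclics_def)
qed (auto simp: totally_cyclics_def)

lemma ac_le_card_acyclics: "finite E \<Longrightarrow> ac (\<lambda>_. edge) E C \<le> card (acyclics E C)"
proof (induction E arbitrary: C rule: finite_induct)
  case empty
  have "acyclics {} C = {{}}" by (auto simp: acyclics_def no_closed_walk_def)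
  then show ?case by (simp add: ac_def expansion_empty)
next
  case (insert e E)
  show ?case
  proof (cases "spanned e C")
    case True
    \<comment> \<open>With the label \<open>edge\<close> a loop contributes the factor
      \<open>1 - 1 = 0\<close>.\<close>
    then show ?thesis by (simp add: ac_insert insert.hyps edge_def)
  next
    case False
    then show ?thesis
      using insert.IH[of C] insert.IH[of "insert e C"] card_acyclics_insert[OF insert.hyps False]
      by (simp add: ac_insert insert.hyps edge_def)
  qed
qed

lemma tc_le_card_totally_cyclics: "finite E \<Longrightarrow> tc (\<lambda>_. edge) E C \<le> card (totally_cyclics E C)"
proof (induction E arbitrary: C rule: finite_induct)
  case empty
  have "totally_cyclics {} C = {{}}" by (auto simp: totally_cyclics_def all_closed_walk_def)
  then show ?case by (simp add: tc_def expansion_empty)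
next
  case (insert e E)
  show ?case
  proof (cases "spanned e (E \<union> C)")
    case False
    then show ?thesis by (simp add: tc_insert insert.hyps edge_def)
  next
    case True
    then show ?thesis
      using insert.IH[of C] insert.IH[of "insert e C"] card_totally_cyclics_insert[OF insert.hyps True]
      by (simp add: tc_insert insert.hyps edge_def)
  qed
qed

end

section \<open>Models of the complete graph on four vertices\<close>

definition connected_on :: "'a rel \<Rightarrow> 'a set \<Rightarrow> bool" where
  "connected_on R B \<longleftrightarrow> (\<forall>x\<in>B. \<forall>y\<in>B. (x, y) \<in> (R \<inter> B \<times> B)\<^sup>*)"

definition touching :: "'a rel \<Rightarrow> 'a set \<Rightarrow> 'a set \<Rightarrow> bool" where
  "touching R A B \<longleftrightarrow> (\<exists>x\<in>A. \<exists>y\<in>B. (x, y) \<in> R)"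

definition K4_model :: "'a rel \<Rightarrow> (nat \<Rightarrow> 'a set) \<Rightarrow> bool" where
  "K4_model R P \<longleftrightarrow> (\<forall>i<4. P i \<noteq> {} \<and> connected_on R (P i)) \<and>
     (\<forall>i<4. \<forall>j<4. i \<noteq> j \<longrightarrow> P i \<inter> P j = {} \<and> touching R (P i) (P j))"

text \<open>The lower bound on the length excludes an edge traversed back and forth, which a
  symmetric relation would allow.\<close>

definition cycle_in :: "'a rel \<Rightarrow> 'a set \<Rightarrow> 'a list \<Rightarrow> bool" where
  "cycle_in R W zs \<longleftrightarrow> 3 \<le> length zs \<and> distinct zs \<and> set zs \<subseteq> W \<and>
     successively (\<lambda>x y. (x, y) \<in> R) zs \<and> (last zs, hd zs) \<in> R"

lemma touching_sym: "sym R \<Longrightarrow> touching R A B \<Longrightarrow> touching R B A"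
  unfolding touching_def by (meson symD)

lemma less_4_iff: "i < 4 \<longleftrightarrow> i = 0 \<or> i = 1 \<or> i = 2 \<or> i = (3::nat)"
  by auto

lemma K4_modelI:
  assumes "sym R" "\<And>X. X \<in> {A, B, C, D} \<Longrightarrow> X \<noteq> {} \<and> connected_on R X"
    and "A \<inter> B = {}" "A \<inter> C = {}" "A \<inter> D = {}" "B \<inter> C = {}" "B \<inter> D = {}" "C \<inter> D = {}"
    and "touching R A B" "touching R A C" "touching R A D" "touching R B C" "touching R B D"
      "touching R C D"
  shows "\<exists>P. K4_model R P \<and> (\<Union>i<4. P i) = A \<union> B \<union> C \<union> D"
proof -
  define P where "P = (\<lambda>i::nat. if i = 0 then A else if i = 1 then B else if i = 2 then C else D)"
  have P: "P 0 = A" "P 1 = B" "P (Suc 0) = B" "P 2 = C" "P 3 = D" by (auto simp: P_def)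
  have "K4_model R P"
    unfolding K4_model_def less_4_iff
    using assms touching_sym[OF assms(1)] by (auto simp: P Int_commute)
  moreover have "(\<Union>i<4. P i) = A \<union> B \<union> C \<union> D"
    by (auto simp: less_4_iff P_def split: if_splits)
  ultimately show ?thesis by blast
qed

lemma connected_on_insert:
  assumes "sym R" "connected_on R B" "b \<in> B" "(b, x) \<in> R"
  shows "connected_on R (insert x B)"
proof -
  let ?S = "R \<inter> insert x B \<times> insert x B"
  have sub: "(R \<inter> B \<times> B)\<^sup>* \<subseteq> ?S\<^sup>*" by (rule rtrancl_mono) auto
  have bx: "(b, x) \<in> ?S\<^sup>*" "(x, b) \<in> ?S\<^sup>*"
    using assms(3,4) symD[OF assms(1,4)] by auto
  have "(y, b) \<in> ?S\<^sup>* \<and> (b, y) \<in> ?S\<^sup>*" if "y \<in> insert x B" for y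
    using that bx assms(2,3) sub unfolding connected_on_def by blast
  then show ?thesis unfolding connected_on_def by (meson rtrancl_trans)
qed

lemma connected_on_successively:
  assumes "sym R" "successively (\<lambda>x y. (x, y) \<in> R) xs"
  shows "connected_on R (set xs)"
  using assms(2)
proof (induction xs)
  case (Cons x xs)
  show ?case
  proof (cases xs)
    case (Cons y ys)
    then have "connected_on R (set xs)" "(y, x) \<in> R" "y \<in> set xs"
      using Cons.IH Cons.prems symD[OF assms(1)] by auto
    then show ?thesis using connected_on_insert[OF assms(1)] by fastforce
  qed (simp add: connected_on_def)
qed (simp add: connected_on_def)

section \<open>Cycles from longest paths\<close>

lemma cycle_in_rotate:
  assumes "cycle_in R W (xs @ ys)"
  shows "cycle_in R W (ys @ xs)"
proof (cases "xs = [] \<or> ys = []")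
  case False
  then have "hd (xs @ ys) = hd xs" "last (xs @ ys) = last ys" "hd (ys @ xs) = hd ys"
    "last (ys @ xs) = last xs"
    by (simp_all add: hd_append last_append)
  then show ?thesis
    using assms False unfolding cycle_in_def successively_append_iff by auto
qed (use assms in auto)

text \<open>Both neighbours of the first vertex lie on the path, and one of them is not the second
  vertex; it closes a cycle.\<close>

lemma cycle_of_maximal_path:
  assumes sym: "sym R"
    and path: "distinct p" "set p \<subseteq> W" "successively (\<lambda>x y. (x, y) \<in> R) p" "p \<noteq> []"
    and maximal: "\<And>q. distinct q \<Longrightarrow> set q \<subseteq> W \<Longrightarrow> successively (\<lambda>x y. (x, y) \<in> R) q \<Longrightarrow>
      length q \<le> length p"
    and nbs: "a \<noteq> b" "a \<in> W" "b \<in> W" "a \<noteq> hd p" "b \<noteq> hd p" "(hd p, a) \<in> R" "(hd p, b) \<in> R"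
  shows "\<exists>zs. cycle_in R W zs"
proof -
  obtain v q where p: "p = v # q" using path(4) by (cases p) auto
  have on_path: "c \<in> set q" if "c \<in> W" "c \<noteq> v" "(v, c) \<in> R" for c
  proof (rule ccontr)
    assume "c \<notin> set q"
    then have "length (c # p) \<le> length p"
      using that path symD[OF sym that(3)] by (intro maximal) (auto simp: p)
    then show False by simp
  qed
  have "a \<in> set q" "b \<in> set q" using on_path nbs by (auto simp: p)
  then obtain u where u: "u \<in> set q" "u \<noteq> hd q" "(v, u) \<in> R"
    using nbs by (metis list.sel(1) p)
  then obtain as bs where q: "q = as @ u # bs" by (meson split_list)
  then have "as \<noteq> []" using u(2) by auto
  have "p = (v # as @ [u]) @ bs" by (simp add: p q)
  then have "successively (\<lambda>x y. (x, y) \<in> R) (v # as @ [u])"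
    using path(3) by (metis successively_append_iff)
  then have "cycle_in R W (v # as @ [u])"
    using path(1,2) symD[OF sym u(3)] \<open>as \<noteq> []\<close> unfolding p q cycle_in_def
    by (auto simp: Suc_le_eq numeral_3_eq_3)
  then show ?thesis by blast
qed

text \<open>One vertex \<open>y\<close> may have small degree: the two ends of a longest path are
  distinct, so one of them differs from \<open>y\<close>, and the path is reversed if
  necessary.\<close>

lemma cycle_exists:
  assumes "sym R" "irrefl R" "finite W" "w \<in> W" "w \<noteq> y"
    and deg: "\<And>x. x \<in> W \<Longrightarrow> x \<noteq> y \<Longrightarrow> \<exists>a\<in>W. \<exists>b\<in>W. a \<noteq> b \<and> (x, a) \<in> R \<and> (x, b) \<in> R"
  shows "\<exists>zs. cycle_in R W zs"
proof -
  let ?path = "\<lambda>p. distinct p \<and> set p \<subseteq> W \<and> successively (\<lambda>x y. (x, y) \<in> R) p"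
  have neq: "a \<noteq> x" if "(x, a) \<in> R" for a x using that assms(2) by (auto simp: irrefl_def)
  have bound: "length p \<le> card W" if "?path p" for p
    using that assms(3) by (metis card_mono distinct_card)
  obtain p where p: "?path p" and max: "\<And>q. ?path q \<Longrightarrow> length q \<le> length p"
    using ex_has_greatest_nat[of ?path "[]" length "Suc (card W)"] bound
    by (auto simp: less_Suc_eq_le)
  obtain a where a: "a \<in> W" "(w, a) \<in> R" using deg[OF assms(4,5)] by blast
  have "?path [w, a]" using a assms(4) neq by fastforce
  then have len: "2 \<le> length p" using max by fastforce
  then have "hd p \<noteq> last p" "p \<noteq> []" using p by (cases p; auto)+
  have *: "\<exists>zs. cycle_in R W zs" if q: "?path q" "length q = length p" "hd q \<noteq> y" for q
  proof -
    have "q \<noteq> []" using q(2) len by auto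
    then obtain a b where ab: "a \<in> W" "b \<in> W" "a \<noteq> b" "(hd q, a) \<in> R" "(hd q, b) \<in> R"
      using deg[of "hd q"] q by (meson hd_in_set subsetD)
    have "length q' \<le> length q"
      if "distinct q'" "set q' \<subseteq> W" "successively (\<lambda>x y. (x, y) \<in> R) q'" for q'
      using max that q(2) by simp
    then show ?thesis
      using cycle_of_maximal_path[OF assms(1), of q W a b] q(1) \<open>q \<noteq> []\<close> ab
        neq[OF ab(4)] neq[OF ab(5)] by blast
  qed
  have "successively (\<lambda>x y. (x, y) \<in> R) (rev p)"
    using p symD[OF assms(1)] unfolding successively_rev by (metis (no_types, lifting) successively_mono)
  then have "?path (rev p)" using p by simp
  moreover have "hd (rev p) = last p" using \<open>p \<noteq> []\<close> by (simp add: hd_rev)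
  ultimately show ?thesis
    using *[of p] *[of "rev p"] p \<open>hd p \<noteq> last p\<close> by (cases "hd p = y") auto
qed


text \<open>The cycle is cut into three arcs, each starting at a neighbour of \<open>B\<close>;
  these arcs and \<open>B\<close> are the four branch sets.\<close>

lemma K4_model_of_attached_cycle:
  assumes "sym R" "connected_on R B" "B \<noteq> {}" "cycle_in R W zs" "B \<inter> W = {}"
    and N: "N \<subseteq> set zs" "\<And>x. x \<in> N \<Longrightarrow> \<exists>b\<in>B. (b, x) \<in> R" "3 \<le> card N"
  shows "\<exists>P. K4_model R P \<and> (\<Union>i<4. P i) \<subseteq> B \<union> W"
proof -
  obtain x where x: "x \<in> N" using N(3) by fastforce
  then obtain us vs where zs: "zs = us @ x # vs" using N(1) by (meson split_list subsetD)
  have cyc: "cycle_in R W (x # vs @ us)"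
    using cycle_in_rotate[of R W us "x # vs"] assms(4) by (simp add: zs)
  define rest where "rest = vs @ us"
  have fin: "finite N" using N(1) finite_subset by blast
  have "2 \<le> card (N - {x})" using N(3) x fin by simp
  then obtain y z where yz: "y \<in> N - {x}" "z \<in> N - {x}" "y \<noteq> z"
    by (metis card_le_Suc0_iff_eq finite_Diff fin not_less_eq_eq numeral_2_eq_2)
  then have "y \<in> set rest" "z \<in> set rest" using N(1) zs by (auto simp: rest_def)
  \<comment> \<open>The names \<open>y\<close> and \<open>z\<close> are exchanged if necessary to
    match their order along the cycle.\<close>
  have "\<exists>as y bs z cs. rest = as @ y # bs @ z # cs \<and> y \<in> N \<and> z \<in> N"
  proof -
    obtain as bs where 1: "rest = as @ y # bs" using \<open>y \<in> set rest\<close> by (meson split_list)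
    then consider "z \<in> set as" | "z \<in> set bs" using \<open>z \<in> set rest\<close> yz(3) by auto
    then show ?thesis
    proof cases
      case 1
      then obtain cs ds where "as = cs @ z # ds" by (meson split_list)
      then have "rest = cs @ z # ds @ y # bs" using \<open>rest = as @ y # bs\<close> by simp
      then show ?thesis using yz by blast
    next
      case 2
      then obtain cs ds where "bs = cs @ z # ds" by (meson split_list)
      then have "rest = as @ y # cs @ z # ds" using 1 by simp
      then show ?thesis using yz by blast
    qed
  qed
  then obtain as y bs z cs where rest: "rest = as @ y # bs @ z # cs" and yz: "y \<in> N" "z \<in> N"
    by blast
  let ?X = "x # as" and ?Y = "y # bs" and ?Z = "z # cs"
  have cyc: "cycle_in R W (?X @ ?Y @ ?Z)" using cyc by (simp add: rest rest_def[symmetric])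
  then have sub: "set ?X \<union> set ?Y \<union> set ?Z \<subseteq> W" by (auto simp: cycle_in_def)
  have "(last ?X, y) \<in> R" "(last ?Y, z) \<in> R"
    using cyc unfolding cycle_in_def successively_append_iff by simp_all
  moreover have "last ?X \<in> set ?X" "last ?Y \<in> set ?Y" by (rule last_in_set; simp)+
  ultimately have "touching R (set ?X) (set ?Y)" "touching R (set ?Y) (set ?Z)"
    unfolding touching_def by auto
  moreover have "touching R (set ?X) (set ?Z)"
  proof -
    have "(last ?Z, x) \<in> R" using cyc by (simp add: cycle_in_def)
    then show ?thesis using symD[OF assms(1)] last_in_set[of ?Z] unfolding touching_def by auto
  qed
  moreover have "touching R B (set ?X)" "touching R B (set ?Y)" "touching R B (set ?Z)"
    using N(2) x yz by (auto simp: touching_def)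
  moreover have "connected_on R (set ?X)" "connected_on R (set ?Y)" "connected_on R (set ?Z)"
    using cyc unfolding cycle_in_def successively_append_iff
    by (blast intro: connected_on_successively[OF assms(1)])+
  moreover have "set ?X \<inter> set ?Y = {}" "set ?X \<inter> set ?Z = {}" "set ?Y \<inter> set ?Z = {}"
    using cyc by (auto simp: cycle_in_def)
  moreover have "B \<inter> set ?X = {}" "B \<inter> set ?Y = {}" "B \<inter> set ?Z = {}"
    using sub assms(5) by auto
  ultimately obtain P where "K4_model R P" "(\<Union>i<4. P i) = B \<union> set ?X \<union> set ?Y \<union> set ?Z"
    using K4_modelI[OF assms(1), of B "set ?X" "set ?Y" "set ?Z"] assms(2,3) by auto
  then show ?thesis using sub by (intro exI[of _ P]) auto
qed

lemma two_neighbours: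
  assumes "3 \<le> card (R `` {x})" "R `` {x} \<subseteq> insert z W"
  shows "\<exists>a\<in>W. \<exists>b\<in>W. a \<noteq> b \<and> (x, a) \<in> R \<and> (x, b) \<in> R"
proof -
  have fin: "finite (R `` {x})" using assms(1) card.infinite by fastforce
  have "2 \<le> card (R `` {x} - {z})" using assms(1) fin by (auto simp: card_Diff_singleton_if)
  then obtain a b where "a \<in> R `` {x} - {z}" "b \<in> R `` {x} - {z}" "a \<noteq> b"
    by (metis card_le_Suc0_iff_eq finite_Diff fin not_less_eq_eq numeral_2_eq_2)
  then show ?thesis using assms(2) by blast
qed

text \<open>
  Dirac's theorem. Among the connected vertex sets whose complement contains a cycle take a largest
  one, \<open>B\<close>. All neighbours of \<open>B\<close> lie on every cycle of its complement, so if there are only two of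
  them, then deleting one of them leaves a forest outside \<open>B\<close>, which the degrees forbid.
\<close>

lemma K4_model_of_min_degree_connected:
  assumes "sym R" "irrefl R" "finite V" "V \<noteq> {}" "R \<subseteq> V \<times> V"
    and deg: "\<And>v. v \<in> V \<Longrightarrow> 3 \<le> card (R `` {v})"
    and conn: "\<And>u v. u \<in> V \<Longrightarrow> v \<in> V \<Longrightarrow> (u, v) \<in> R\<^sup>*"
  shows "\<exists>P. K4_model R P \<and> (\<Union>i<4. P i) \<subseteq> V"
proof -
  let ?good = "\<lambda>B. B \<subseteq> V \<and> B \<noteq> {} \<and> connected_on R B \<and> (\<exists>zs. cycle_in R (V - B) zs)"
  have neq: "a \<noteq> x" if "(x, a) \<in> R" for a x using that assms(2) by (auto simp: irrefl_def)
  obtain v where v: "v \<in> V" using assms(4) by blast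
  have "\<exists>zs. cycle_in R (V - {v}) zs"
  proof -
    have "R `` {v} \<noteq> {}" using deg[OF v] by auto
    then obtain w where w: "(v, w) \<in> R" by auto
    show ?thesis
    proof (rule cycle_exists[OF assms(1,2)])
      show "w \<in> V - {v}" using w neq assms(5) by auto
      then show "w \<noteq> v" by simp
      show "\<exists>a\<in>V - {v}. \<exists>b\<in>V - {v}. a \<noteq> b \<and> (x, a) \<in> R \<and> (x, b) \<in> R" if "x \<in> V - {v}" for x
        using deg[of x] that assms(5) by (intro two_neighbours[of _ _ v]) auto
    qed (use assms(3) in simp)
  qed
  then have "?good {v}" using v by (simp add: connected_on_def)
  moreover have "card B < Suc (card V)" if "?good B" for B
    using that assms(3) by (simp add: card_mono less_Suc_eq_le)
  ultimately obtain B where B: "?good B" and max: "\<And>B'. ?good B' \<Longrightarrow> card B' \<le> card B"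
    using ex_has_greatest_nat[of ?good "{v}" card "Suc (card V)"] by blast
  have finB: "finite B" using B assms(3) finite_subset by blast
  define N where "N = {x \<in> V - B. \<exists>b\<in>B. (b, x) \<in> R}"
  have N_cycle: "N \<subseteq> set zs" if zs: "cycle_in R (V - B) zs" for zs
  proof
    fix x assume x: "x \<in> N"
    show "x \<in> set zs"
    proof (rule ccontr)
      assume "x \<notin> set zs"
      then have "cycle_in R (V - insert x B) zs" using zs by (auto simp: cycle_in_def)
      moreover have "connected_on R (insert x B)"
        using x B connected_on_insert[OF assms(1)] by (auto simp: N_def)
      ultimately have "?good (insert x B)" using x B by (auto simp: N_def)
      then show False using max[of "insert x B"] x finB by (simp add: N_def)
    qed
  qed
  obtain zs where zs: "cycle_in R (V - B) zs" using B by blast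
  show ?thesis
  proof (cases "3 \<le> card N")
    case True
    have "\<exists>P. K4_model R P \<and> (\<Union>i<4. P i) \<subseteq> B \<union> (V - B)"
      using B True N_cycle[OF zs] by (intro K4_model_of_attached_cycle[OF assms(1) _ _ zs]) (auto simp: N_def)
    then show ?thesis using B by (simp add: Un_absorb1)
  next
    case False
    obtain b c where bc: "b \<in> B" "c \<in> V - B"
      using B zs unfolding cycle_in_def by (metis all_not_in_conv hd_in_set list.size(3) not_numeral_le_zero subsetD)
    have "\<exists>x. x \<in> N"
    proof (rule ccontr)
      assume none: "\<nexists>x. x \<in> N"
      have "(b, c) \<in> R\<^sup>*" using conn bc B by auto
      then have "c \<in> B"
      proof (induction rule: rtrancl_induct)
        case (step y z)
        then show ?case using none assms(5) by (auto simp: N_def)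
      qed (rule bc(1))
      then show False using bc(2) by simp
    qed
    then obtain x where x: "x \<in> N" by blast
    have finN: "finite N" using assms(3) by (simp add: N_def)
    have "card (N - {x}) \<le> 1" using False x finN by simp
    then obtain y where y: "N \<subseteq> {x, y}"
      using finN by (metis card_le_Suc0_iff_eq finite_Diff One_nat_def Diff_subset_conv insert_is_Un
        subsetI insertCI)
    have "\<exists>zs. cycle_in R (V - B - {x}) zs"
    proof -
      \<comment> \<open>A cycle has at least three vertices, so one avoids \<open>x\<close> and
        \<open>y\<close>. It serves as the start vertex in \<open>cycle_exists\<close>, with
        \<open>y\<close> as the exceptional vertex.\<close>
      have "card (set zs - {x, y}) \<ge> 1"
        using zs card_Diff_subset[of "{x, y}" "set zs"] diff_card_le_card_Diff[of "{x, y}" "set zs"]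
          distinct_card[of zs] card_insert_le_m1[of 2 "{y}" x]
        by (auto simp: cycle_in_def)
      then obtain w where w: "w \<in> set zs" "w \<noteq> x" "w \<noteq> y"
        by (metis Diff_iff card.empty ex_in_conv insertCI not_one_le_zero)
      show ?thesis
      proof (rule cycle_exists[OF assms(1,2)])
        show "w \<in> V - B - {x}" using w zs by (auto simp: cycle_in_def)
        show "w \<noteq> y" by fact
        show "\<exists>a\<in>V - B - {x}. \<exists>b\<in>V - B - {x}. a \<noteq> b \<and> (u, a) \<in> R \<and> (u, b) \<in> R"
          if u: "u \<in> V - B - {x}" "u \<noteq> y" for u
        proof (rule two_neighbours)
          have "u \<notin> N" using u y by auto
          then show "R `` {u} \<subseteq> insert x (V - B - {x})"
            using u assms(5) symD[OF assms(1)] by (fastforce simp: N_def)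
        qed (use u deg in auto)
      qed (use assms(3) in simp)
    qed
    then obtain zs' where zs': "cycle_in R (V - B - {x}) zs'" by blast
    then have "cycle_in R (V - B) zs'" by (auto simp: cycle_in_def)
    then have "x \<in> set zs'" using N_cycle x by blast
    then show ?thesis using zs' by (auto simp: cycle_in_def)
  qed
qed

text \<open>Only adjacencies inside the union of the branch sets matter, so a model survives the
  deletion of any other vertex.\<close>

lemma K4_model_mono:
  assumes "K4_model R P" "\<And>x y. x \<in> (\<Union>i<4. P i) \<Longrightarrow> y \<in> (\<Union>i<4. P i) \<Longrightarrow> (x, y) \<in> R \<Longrightarrow> (x, y) \<in> S"
  shows "K4_model S P"
proof -
  have "(R \<inter> P i \<times> P i)\<^sup>* \<subseteq> (S \<inter> P i \<times> P i)\<^sup>*" if "i < 4" for i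
    using that assms(2) by (intro rtrancl_mono) blast
  then have "connected_on S (P i)" if "i < 4" for i
    using assms(1) that unfolding K4_model_def connected_on_def by blast
  moreover have "touching S (P i) (P j)" if "i < 4" "j < 4" "i \<noteq> j" for i j
  proof -
    have "touching R (P i) (P j)" using assms(1) that by (simp add: K4_model_def)
    then obtain x y where xy: "x \<in> P i" "y \<in> P j" "(x, y) \<in> R" by (auto simp: touching_def)
    then have "(x, y) \<in> S" using that by (intro assms(2)) auto
    then show ?thesis using xy by (auto simp: touching_def)
  qed
  ultimately show ?thesis using assms(1) unfolding K4_model_def by blast
qed

lemma K4_model_of_min_degree:
  assumes "sym R" "irrefl R" "finite R" "R \<noteq> {}"
    and deg: "\<And>v. v \<in> Domain R \<Longrightarrow> 3 \<le> card (R `` {v})"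
  shows "\<exists>P. K4_model R P"
proof -
  obtain v where v: "v \<in> Domain R" using assms(4) by auto
  define V where "V = R\<^sup>* `` {v}"
  define S where "S = R \<inter> V \<times> V"
  have symR: "sym (R\<^sup>*)" using assms(1) by (rule sym_rtrancl)
  have closed: "y \<in> V" if "x \<in> V" "(x, y) \<in> R" for x y
    using that by (auto simp: V_def intro: rtrancl_into_rtrancl)
  have dom: "x \<in> Domain R" if "x \<in> V" for x
  proof -
    have "(v, x) \<in> R\<^sup>*" using that by (simp add: V_def)
    then show ?thesis using v symD[OF assms(1)] by (cases rule: rtranclE) auto
  qed
  have S_img: "S `` {x} = R `` {x}" if "x \<in> V" for x
    using that closed by (auto simp: S_def)
  have path: "(v, x) \<in> S\<^sup>*" if "x \<in> V" for x
  proof -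
    have "(v, x) \<in> R\<^sup>*" using that by (simp add: V_def)
    then show ?thesis
    proof (induction rule: rtrancl_induct)
      case (step y z)
      then have "y \<in> V" by (simp add: V_def)
      then have "(y, z) \<in> S" using step closed by (auto simp: S_def)
      then show ?case using step by (auto intro: rtrancl_into_rtrancl)
    qed simp
  qed
  have "\<exists>P. K4_model S P \<and> (\<Union>i<4. P i) \<subseteq> V"
  proof (rule K4_model_of_min_degree_connected)
    show symS: "sym S" using assms(1) by (auto simp: S_def sym_def)
    show "irrefl S" using assms(2) by (auto simp: S_def irrefl_def)
    have "V \<subseteq> Domain R" using dom by auto
    then show "finite V" using assms(3) finite_Domain finite_subset by blast
    show "V \<noteq> {}" by (auto simp: V_def)
    show "3 \<le> card (S `` {x})" if "x \<in> V" for x using deg dom S_img that by simp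
    show "(x, y) \<in> S\<^sup>*" if "x \<in> V" "y \<in> V" for x y
      using path[OF that(1)] path[OF that(2)] symD[OF sym_rtrancl[OF symS]] by (meson rtrancl_trans)
  qed (auto simp: S_def)
  then show ?thesis using K4_model_mono[of S _ R] by (auto simp: S_def)
qed

lemma K4_model_Field:
  assumes "K4_model R P" "i < 4"
  shows "P i \<subseteq> Field R"
proof
  fix x assume x: "x \<in> P i"
  obtain j where j: "j < 4" "j \<noteq> i" using that[of 0] that[of 1] by (cases "i = 0") auto
  then have "touching R (P i) (P j)" "connected_on R (P i)" using assms by (auto simp: K4_model_def)
  then obtain y z where y: "y \<in> P i" "(y, z) \<in> R" "(x, y) \<in> (R \<inter> P i \<times> P i)\<^sup>*"
    using x unfolding touching_def connected_on_def by blast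
  from y(3) show "x \<in> Field R"
    by (cases rule: converse_rtranclE) (use y(2) in \<open>auto simp: Field_def\<close>)
qed

section \<open>Models in contracted graphs\<close>

lemma connected_on_Union:
  assumes "connected_on R \<P>" "\<And>X. X \<in> \<P> \<Longrightarrow> connected_on S X"
    and "\<And>X Y. X \<in> \<P> \<Longrightarrow> Y \<in> \<P> \<Longrightarrow> (X, Y) \<in> R \<Longrightarrow> touching S X Y"
  shows "connected_on S (\<Union>\<P>)"
  unfolding connected_on_def
proof clarify
  let ?T = "S \<inter> \<Union>\<P> \<times> \<Union>\<P>"
  have inner: "(x, y) \<in> ?T\<^sup>*" if "X \<in> \<P>" "x \<in> X" "y \<in> X" for x y X
  proof -
    have "(x, y) \<in> (S \<inter> X \<times> X)\<^sup>*" using assms(2) that by (auto simp: connected_on_def)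
    moreover have "(S \<inter> X \<times> X)\<^sup>* \<subseteq> ?T\<^sup>*" using that(1) by (intro rtrancl_mono) blast
    ultimately show ?thesis by blast
  qed
  fix x X y Y assume XY: "x \<in> X" "X \<in> \<P>" "y \<in> Y" "Y \<in> \<P>"
  then have "(X, Y) \<in> (R \<inter> \<P> \<times> \<P>)\<^sup>*" using assms(1) by (auto simp: connected_on_def)
  then have "Y \<in> \<P> \<longrightarrow> (\<forall>y\<in>Y. (x, y) \<in> ?T\<^sup>*)"
  proof (induction rule: rtrancl_induct)
    case base
    then show ?case using inner XY by blast
  next
    case (step Y Z)
    show ?case
    proof (intro impI ballI)
      fix z assume z: "Z \<in> \<P>" "z \<in> Z"
      obtain y' z' where yz: "y' \<in> Y" "z' \<in> Z" "(y', z') \<in> S"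
        using assms(3)[of Y Z] step.hyps by (auto simp: touching_def)
      have "(x, y') \<in> ?T\<^sup>*" using step yz by blast
      moreover have "(y', z') \<in> ?T" using yz step.hyps by auto
      ultimately show "(x, z) \<in> ?T\<^sup>*"
        using inner[OF z(1) yz(2) z(2)] by (meson rtrancl_into_rtrancl rtrancl_trans)
    qed
  qed
  then show "(x, y) \<in> ?T\<^sup>*" using XY by blast
qed

text \<open>Lifts a model from a contracted graph, whose vertices are disjoint connected vertex
  sets, to the graph before contraction.\<close>

lemma K4_model_Union:
  assumes "K4_model R P"
    and conn: "\<And>X. X \<in> Field R \<Longrightarrow> connected_on S X \<and> X \<noteq> {}"
    and touch: "\<And>X Y. (X, Y) \<in> R \<Longrightarrow> touching S X Y"
    and disj: "\<And>X Y. X \<in> Field R \<Longrightarrow> Y \<in> Field R \<Longrightarrow> X \<noteq> Y \<Longrightarrow> X \<inter> Y = {}"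
  shows "K4_model S (\<lambda>i. \<Union>(P i))"
proof -
  note field = K4_model_Field[OF assms(1)]
  have P: "P i \<noteq> {}" "connected_on R (P i)" if "i < 4" for i
    using assms(1) that by (auto simp: K4_model_def)
  have PP: "P i \<inter> P j = {}" "touching R (P i) (P j)" if "i < 4" "j < 4" "i \<noteq> j" for i j
    using assms(1) that by (auto simp: K4_model_def)
  have "connected_on S (\<Union>(P i))" if "i < 4" for i
    using P(2)[OF that] field[OF that] conn touch by (intro connected_on_Union[of R]) auto
  moreover have "\<Union>(P i) \<noteq> {}" if "i < 4" for i
    using P(1)[OF that] field[OF that] conn by blast
  moreover have "\<Union>(P i) \<inter> \<Union>(P j) = {}" if "i < 4" "j < 4" "i \<noteq> j" for i j
  proof -
    have "X \<inter> Y = {}" if "X \<in> P i" "Y \<in> P j" for X Y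
      using disj[of X Y] that field[OF \<open>i < 4\<close>] field[OF \<open>j < 4\<close>] PP(1)[OF \<open>i < 4\<close> \<open>j < 4\<close> \<open>i \<noteq> j\<close>]
      by blast
    then show ?thesis by blast
  qed
  moreover have "touching S (\<Union>(P i)) (\<Union>(P j))" if ij: "i < 4" "j < 4" "i \<noteq> j" for i j
  proof -
    obtain X Y where XY: "X \<in> P i" "Y \<in> P j" "(X, Y) \<in> R"
      using PP(2)[OF ij] by (auto simp: touching_def)
    then show ?thesis using touch[OF XY(3)] by (auto simp: touching_def)
  qed
  ultimately show ?thesis by (simp add: K4_model_def)
qed

context edge_ends
begin

text \<open>
  In the contracted graph, whose vertices are the components of \<open>C\<close>, a vertex of degree at most two
  would give a bridge or two edges in series.
\<close>

lemma K4_model_of_irreducible: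
  assumes "finite E" "E \<noteq> {}" "loopless_in E C" "bridgeless_in E C" "\<not> reducible E C"
  shows "\<exists>P. K4_model (adj (E \<union> C)) P"
proof -
  define k where "k = (\<lambda>x. conn C `` {x})"
  define R where "R = (\<Union>e\<in>E. {(k (s e), k (t e)), (k (t e), k (s e))})"
  have refl: "x \<in> k x" for x by (simp add: k_def conn_def)
  have k_eq: "k x = k y \<longleftrightarrow> (x, y) \<in> conn C" for x y
    by (simp add: k_def conn_class_eq_iff)
  have k_mem: "y \<in> k x \<longleftrightarrow> k x = k y" for x y by (simp add: k_eq) (simp add: k_def)
  have loopless: "k (s e) \<noteq> k (t e)" if "e \<in> E" for e
    using assms(3) that by (simp add: loopless_in_def spanned_iff k_eq)
  have "\<exists>P. K4_model R P"
  proof (rule K4_model_of_min_degree)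
    show "sym R" by (auto simp: R_def sym_def)
    show "irrefl R" using loopless by (fastforce simp: R_def irrefl_def)
    show "finite R" "R \<noteq> {}" using assms(1,2) by (auto simp: R_def)
    fix X assume X: "X \<in> Domain R"
    define D where "D = {e \<in> E. k (s e) = X \<or> k (t e) = X}"
    define opp where "opp = (\<lambda>e. if k (s e) = X then k (t e) else k (s e))"
    have finD: "finite D" using assms(1) by (simp add: D_def)
    have "R `` {X} = opp ` D"
      using loopless by (fastforce simp: R_def D_def opp_def)
    \<comment> \<open>Two edges at \<open>X\<close> with the same opposite end would be parallel, so
      degrees count edges as well as neighbours.\<close>
    moreover have "inj_on opp D"
    proof (rule inj_onI, rule ccontr)
      fix e f assume ef: "e \<in> D" "f \<in> D" "opp e = opp f" "e \<noteq> f"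
      then have "k (s e) = k (s f) \<and> k (t e) = k (t f) \<or> k (s e) = k (t f) \<and> k (t e) = k (s f)"
        by (auto simp: D_def opp_def split: if_splits)
      then have "spanned f (insert e C)"
        using conn_sym by (auto simp: spanned_iff conn_insert_iff k_eq)
      then show False using assms(5) ef by (auto simp: reducible_def D_def)
    qed
    ultimately have card: "card (R `` {X}) = card D" by (simp add: card_image)
    \<comment> \<open>A walk that avoids the edges at \<open>X\<close> cannot leave
      \<open>X\<close>; hence \<open>D\<close> is a cut.\<close>
    have closed: "k y = X" if "(x, y) \<in> conn (A \<union> C)" "k x = X" "A \<subseteq> E" "A \<inter> D = {}" for x y A
      using that(1) unfolding conn_def
    proof (induction rule: rtrancl_induct)
      case (step y z)
      show ?case
      proof (cases "(y, z) \<in> adj C")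
        case True
        then have "k y = k z" by (auto simp: k_eq conn_def)
        then show ?thesis using step by simp
      next
        case False
        then obtain e where e: "e \<in> A" "(y, z) \<in> {(s e, t e), (t e, s e)}"
          using step.hyps(2) by (auto simp: adj_def)
        then have "e \<in> D" using step.IH that(3) by (auto simp: D_def)
        then show ?thesis using that(4) e(1) by blast
      qed
    qed (rule that(2))
    have cut: "\<not> spanned e (E - D \<union> C)" if "e \<in> D" for e
    proof
      assume "spanned e (E - D \<union> C)"
      then have conn: "(s e, t e) \<in> conn (E - D \<union> C)" "(t e, s e) \<in> conn (E - D \<union> C)"
        using conn_sym by (auto simp: spanned_iff)
      have "k (s e) = X \<longleftrightarrow> k (t e) = X"
        using closed[OF conn(1)] closed[OF conn(2)] by blast
      then show False using that loopless[of e] by (auto simp: D_def)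
    qed
    have "D \<noteq> {}" using X by (auto simp: R_def D_def)
    then have "card D \<noteq> 0" using finD by simp
    moreover have "card D \<noteq> 1"
    proof
      assume "card D = 1"
      then obtain e where e: "D = {e}" by (rule card_1_singletonE)
      then have "e \<in> E" by (auto simp: D_def)
      then show False using cut[of e] assms(4) e by (auto simp: bridgeless_in_def)
    qed
    moreover have "card D \<noteq> 2"
    proof
      assume "card D = 2"
      then obtain e f where ef: "D = {e, f}" "e \<noteq> f" by (auto simp: card_2_iff)
      then have "e \<in> E" "f \<in> E" by (auto simp: D_def)
      then show False using cut[of e] assms(5) ef by (auto simp: reducible_def)
    qed
    ultimately show "3 \<le> card (R `` {X})" unfolding card by linarith
  qed
  then obtain P where P: "K4_model R P" ..
  have "K4_model (adj (E \<union> C)) (\<lambda>i. \<Union>(P i))"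
  proof (rule K4_model_Union[OF P])
    fix X assume "X \<in> Field R"
    then obtain v where X: "X = k v" by (auto simp: R_def Field_def)
    have "(x, y) \<in> (adj (E \<union> C) \<inter> X \<times> X)\<^sup>*" if "x \<in> X" "y \<in> X" for x y
    proof -
      have "(x, y) \<in> (adj C)\<^sup>*" using that unfolding X k_mem conn_def[symmetric] by (metis k_eq)
      then show ?thesis
      proof (induction rule: rtrancl_induct)
        case (step y z)
        have "(x, y) \<in> conn C" "(x, z) \<in> conn C" using step.hyps by (auto simp: conn_def)
        then have "y \<in> X" "z \<in> X" using that(1) by (auto simp: X k_mem k_eq dest: conn_trans)
        moreover have "(y, z) \<in> adj (E \<union> C)" using step.hyps(2) by (auto simp: adj_def)
        ultimately show ?case using step.IH by (meson IntI SigmaI rtrancl_into_rtrancl)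
      qed simp
    qed
    then show "connected_on (adj (E \<union> C)) X \<and> X \<noteq> {}"
      using refl[of v] X by (auto simp: connected_on_def)
  next
    fix X Y assume "(X, Y) \<in> R"
    then obtain e where "e \<in> E" "(X, Y) = (k (s e), k (t e)) \<or> (X, Y) = (k (t e), k (s e))"
      by (auto simp: R_def)
    then show "touching (adj (E \<union> C)) X Y"
      using refl[of "s e"] refl[of "t e"] by (fastforce simp: touching_def adj_def)
  next
    fix X Y assume "X \<in> Field R" "Y \<in> Field R" and neq: "X \<noteq> Y"
    then obtain v w where XY: "X = k v" "Y = k w" by (auto simp: R_def Field_def)
    show "X \<inter> Y = {}"
    proof (rule ccontr)
      assume "X \<inter> Y \<noteq> {}"
      then obtain z where "z \<in> k v" "z \<in> k w" using XY by auto
      then show False using neq by (simp add: XY k_mem)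
    qed
  qed
  then show ?thesis by blast
qed

end

section \<open>From models to minors\<close>

lemma minor_of_delete_edges:
  assumes "finite D" "D \<subseteq> medges G"
  shows "minor_of (G\<lparr>medges := medges G - D\<rparr>) G"
  using assms
proof (induction D arbitrary: G rule: finite_induct)
  case empty
  then show ?case by (simp add: minor_of.minor_refl)
next
  case (insert e D)
  have "minor_of ((delete_edge G e)\<lparr>medges := medges (delete_edge G e) - D\<rparr>) (delete_edge G e)"
    using insert by (intro insert.IH) (auto simp: delete_edge_def)
  moreover have "(delete_edge G e)\<lparr>medges := medges (delete_edge G e) - D\<rparr> =
      G\<lparr>medges := medges G - insert e D\<rparr>"
    by (simp add: delete_edge_def Diff_insert2 set_diff_eq)
  ultimately show ?case
    using insert.prems minor_of.minor_delete_edge[of e G] by auto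
qed

text \<open>For each pair of vertices one edge is kept, and the isomorphism sends it to the pair of
  indices of its ends.\<close>

lemma K4_minor_of_singletons:
  fixes p :: "nat \<Rightarrow> 'v"
  assumes fin: "finite (medges G)" and V: "mverts G = p ` {..<4}" "inj_on p {..<4}"
    and adj: "\<And>i j. i < 4 \<Longrightarrow> j < 4 \<Longrightarrow> i \<noteq> j \<Longrightarrow> (p i, p j) \<in> adj_rel G"
  shows "has_minor G (complete_multigraph 4)"
proof -
  let ?S = "{S. S \<subseteq> {..<4::nat} \<and> card S = 2}"
  have "\<exists>e. e \<in> medges G \<and> mends G e = p ` S" if S: "S \<in> ?S" for S
  proof -
    obtain i j where ij: "S = {i, j}" "i \<noteq> j" using S by (auto simp: card_2_iff)
    then have "(p i, p j) \<in> adj_rel G" using S by (intro adj) auto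
    then show ?thesis using ij by (auto simp: adj_rel_def)
  qed
  then obtain h where h: "\<And>S. S \<in> ?S \<Longrightarrow> h S \<in> medges G \<and> mends G (h S) = p ` S"
    by metis
  define f where "f = the_inv_into {..<4} p"
  have f: "f (p i) = i" if "i < 4" for i
    using the_inv_into_f_f[OF V(2)] that by (simp add: f_def)
  have f_image: "f ` (p ` S) = S" if "S \<in> ?S" for S
    using f that by (force simp: image_image)
  have key: "f ` mends G (h S) = S" if "S \<in> ?S" for S
    using h[OF that] f_image[OF that] by simp
  define H where "H = G\<lparr>medges := h ` ?S\<rparr>"
  have "H = G\<lparr>medges := medges G - (medges G - h ` ?S)\<rparr>"
    unfolding H_def using h by (intro arg_cong[where f = "\<lambda>X. G\<lparr>medges := X\<rparr>"]) blast
  then have "minor_of H G" using minor_of_delete_edges[of "medges G - h ` ?S" G] fin by simp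
  moreover have "isomorphic_multigraphs H (complete_multigraph 4)"
    unfolding isomorphic_multigraphs_def
  proof (intro exI conjI)
    show "bij_betw f (mverts H) (mverts (complete_multigraph 4))"
      using V f by (intro bij_betwI[where g = p]) (auto simp: H_def complete_multigraph_def)
    show "bij_betw (\<lambda>e. f ` mends G e) (medges H) (medges (complete_multigraph 4))"
    proof -
      have "(\<lambda>e. f ` mends G e) ` h ` ?S = ?S"
        unfolding image_image by (rule trans[OF image_cong[OF refl key] image_ident])
      moreover have "inj_on (\<lambda>e. f ` mends G e) (h ` ?S)"
        by (auto simp: inj_on_def key)
      ultimately show ?thesis by (simp add: bij_betw_def H_def complete_multigraph_def)
    qed
    show "\<forall>e\<in>medges H. mends (complete_multigraph 4) (f ` mends G e) = f ` mends H e"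
      by (simp add: H_def complete_multigraph_def)
  qed
  ultimately show ?thesis by (auto simp: has_minor_def)
qed

lemma has_minor_delete_vertex:
  assumes "v \<in> mverts G" "has_minor (delete_vertex G v) H"
  shows "has_minor G H"
proof -
  obtain H' where "minor_of H' (delete_vertex G v)" "isomorphic_multigraphs H' H"
    using assms(2) by (auto simp: has_minor_def)
  then show ?thesis
    unfolding has_minor_def by (intro exI[of _ H'] conjI minor_of.minor_delete_vertex[OF assms(1)])
qed

lemma has_minor_contract_edge:
  assumes "e \<in> medges G" "mends G e = {u, v}" "u \<noteq> v" "has_minor (contract_edge G e u v) H"
  shows "has_minor G H"
proof -
  obtain H' where "minor_of H' (contract_edge G e u v)" "isomorphic_multigraphs H' H"
    using assms(4) by (auto simp: has_minor_def)
  then show ?thesis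
    unfolding has_minor_def
    by (intro exI[of _ H'] conjI minor_of.minor_contract_edge[OF assms(1-3)])
qed

lemma adj_rel_verts: "finite_multigraph G \<Longrightarrow> (x, y) \<in> adj_rel G \<Longrightarrow> x \<in> mverts G \<and> y \<in> mverts G"
  by (auto simp: adj_rel_def finite_multigraph_def)

text \<open>Meant for the identification of the ends of a contracted edge, hence the alternative
  that an adjacency collapses.\<close>

lemma K4_model_image:
  assumes "K4_model R P" "\<And>x y. (x, y) \<in> R \<Longrightarrow> (f x, f y) \<in> S \<or> f x = f y"
    and disj: "\<And>i j. i < 4 \<Longrightarrow> j < 4 \<Longrightarrow> i \<noteq> j \<Longrightarrow> f ` P i \<inter> f ` P j = {}"
  shows "K4_model S (\<lambda>i. f ` P i)"
proof -
  have "connected_on S (f ` P i)" if "i < 4" for i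
    unfolding connected_on_def
  proof clarify
    fix x y assume xy: "x \<in> P i" "y \<in> P i"
    then have "(x, y) \<in> (R \<inter> P i \<times> P i)\<^sup>*"
      using assms(1) that by (auto simp: K4_model_def connected_on_def)
    then show "(f x, f y) \<in> (S \<inter> f ` P i \<times> f ` P i)\<^sup>*"
    proof (induction rule: rtrancl_induct)
      case (step y z)
      then have "(f y, f z) \<in> S \<inter> f ` P i \<times> f ` P i \<or> f y = f z" using assms(2)[of y z] by blast
      then show ?case using step.IH by (auto intro: rtrancl_into_rtrancl)
    qed simp
  qed
  moreover have "touching S (f ` P i) (f ` P j)" if ij: "i < 4" "j < 4" "i \<noteq> j" for i j
  proof -
    have "touching R (P i) (P j)" using assms(1) ij by (simp add: K4_model_def)
    then obtain x y where xy: "x \<in> P i" "y \<in> P j" "(x, y) \<in> R" by (auto simp: touching_def)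
    then have "f x \<noteq> f y" using disj[OF ij] by auto
    then show ?thesis using assms(2)[OF xy(3)] xy by (auto simp: touching_def)
  qed
  moreover have "f ` P i \<noteq> {}" if "i < 4" for i using assms(1) that by (simp add: K4_model_def)
  ultimately show ?thesis using disj by (simp add: K4_model_def)
qed

text \<open>A vertex outside the branch sets is deleted, an edge inside one of them is contracted.
  Either step loses a vertex, and when none applies the branch sets are single vertices.\<close>

lemma has_K4_minor_of_model:
  assumes "finite_multigraph G" "K4_model (adj_rel G) P"
  shows "has_minor G (complete_multigraph 4)"
  using assms
proof (induction "card (mverts G)" arbitrary: G P rule: less_induct)
  case less
  note G = less.prems(1)
  have finV: "finite (mverts G)" using G by (simp add: finite_multigraph_def)
  have P_disj: "P i \<inter> P j = {}" if "i < 4" "j < 4" "i \<noteq> j" for i j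
    using less.prems(2) that by (simp add: K4_model_def)
  have P_sub: "P i \<subseteq> mverts G" if "i < 4" for i
    using K4_model_Field[OF less.prems(2) that] adj_rel_verts[OF G] by (auto simp: Field_def)
  consider (outside) v where "v \<in> mverts G" "v \<notin> (\<Union>i<4. P i)"
    | (large) i x y where "i < 4" "x \<in> P i" "y \<in> P i" "x \<noteq> y"
    | (single) "mverts G = (\<Union>i<4. P i)" "\<And>i x y. i < 4 \<Longrightarrow> x \<in> P i \<Longrightarrow> y \<in> P i \<Longrightarrow> x = y"
    using P_sub by blast
  then show ?case
  proof cases
    case outside
    have "K4_model (adj_rel (delete_vertex G v)) P"
    proof (rule K4_model_mono[OF less.prems(2)])
      fix x y assume xy: "x \<in> (\<Union>i<4. P i)" "y \<in> (\<Union>i<4. P i)" "(x, y) \<in> adj_rel G"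
      then obtain e where e: "e \<in> medges G" "mends G e = {x, y}" by (auto simp: adj_rel_def)
      have "x \<noteq> v" "y \<noteq> v" using xy(1,2) outside(2) by metis+
      then show "(x, y) \<in> adj_rel (delete_vertex G v)"
        using e by (auto simp: adj_rel_def delete_vertex_def intro!: exI[of _ e])
    qed
    moreover have "finite_multigraph (delete_vertex G v)"
      using G by (auto simp: finite_multigraph_def delete_vertex_def)
    moreover have "card (mverts (delete_vertex G v)) < card (mverts G)"
      using outside(1) by (intro psubset_card_mono[OF finV]) (auto simp: delete_vertex_def)
    ultimately show ?thesis
      using less.hyps has_minor_delete_vertex[OF outside(1)] by blast
  next
    case large
    have "\<exists>u w. (u, w) \<in> adj_rel G \<and> u \<in> P i \<and> w \<in> P i \<and> u \<noteq> w"
    proof (rule ccontr)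
      assume none: "\<not> ?thesis"
      have "(x, y) \<in> (adj_rel G \<inter> P i \<times> P i)\<^sup>*"
        using less.prems(2) large by (auto simp: K4_model_def connected_on_def)
      then have "x = y"
      proof (induction rule: rtrancl_induct)
        case (step y z)
        then show ?case using none by auto
      qed simp
      then show False using large by simp
    qed
    then obtain u w e where uw: "u \<in> P i" "w \<in> P i" "u \<noteq> w" and e: "e \<in> medges G" "mends G e = {u, w}"
      by (auto simp: adj_rel_def)
    let ?f = "\<lambda>x. if x = w then u else x" and ?G = "contract_edge G e u w"
    have u: "u \<in> mverts G" "w \<in> mverts G" using uw P_sub large(1) by auto
    have f_adj: "(?f x, ?f y) \<in> adj_rel ?G \<or> ?f x = ?f y" if xy: "(x, y) \<in> adj_rel G" for x y
    proof -
      obtain g where g: "g \<in> medges G" "mends G g = {x, y}" using xy by (auto simp: adj_rel_def)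
      show ?thesis
      proof (cases "g = e")
        case True
        then show ?thesis using g e by (auto simp: doubleton_eq_iff)
      next
        case False
        then have "g \<in> medges ?G" "mends ?G g = {?f x, ?f y}" using g by (auto simp: contract_edge_def)
        then have "(?f x, ?f y) \<in> adj_rel ?G" unfolding adj_rel_def by blast
        then show ?thesis ..
      qed
    qed
    have "K4_model (adj_rel ?G) (\<lambda>j. ?f ` P j)"
    proof (rule K4_model_image[OF less.prems(2) f_adj])
      fix j k :: nat assume jk: "j < 4" "k < 4" "j \<noteq> k"
      have "w \<notin> P l" "u \<notin> P l" if "l < 4" "l \<noteq> i" for l using P_disj[OF that(1) large(1) that(2)] uw by auto
      then show "?f ` P j \<inter> ?f ` P k = {}"
        using P_disj[OF jk] jk by (cases "j = i"; cases "k = i") auto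
    qed
    moreover have "finite_multigraph ?G"
    proof -
      have "card (?f ` mends G g) \<in> {1, 2}" if "card (mends G g) \<in> {1, 2}" for g
      proof -
        have "finite (mends G g)" "mends G g \<noteq> {}" using that by (auto intro: card_ge_0_finite)
        then show ?thesis
          using card_image_le[of "mends G g" ?f] that card_gt_0_iff[of "?f ` mends G g"] by auto
      qed
      then show ?thesis
        using G u uw(3) by (auto simp: finite_multigraph_def contract_edge_def)
    qed
    moreover have "card (mverts ?G) < card (mverts G)"
      using u by (intro psubset_card_mono[OF finV]) (auto simp: contract_edge_def)
    ultimately show ?thesis
      using less.hyps has_minor_contract_edge[OF e uw(3)] by blast
  next
    case single
    have "\<exists>x. P i = {x}" if "i < 4" for i
    proof -
      have "P i \<noteq> {}" using less.prems(2) that by (simp add: K4_model_def)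
      then show ?thesis using single(2)[OF that] by blast
    qed
    then obtain p where p: "\<And>i. i < 4 \<Longrightarrow> P i = {p i}" by metis
    show ?thesis
    proof (rule K4_minor_of_singletons)
      show "finite (medges G)" using G by (simp add: finite_multigraph_def)
      show "mverts G = p ` {..<4}" using single(1) p by auto
      show "inj_on p {..<4}" using P_disj p by (force simp: inj_on_def)
      show "(p i, p j) \<in> adj_rel G" if "i < 4" "j < 4" "i \<noteq> j" for i j
        using less.prems(2) that p by (auto simp: K4_model_def touching_def)
    qed
  qed
qed

section \<open>Orientations and spanning trees of multigraphs\<close>

locale multigraph_ends = edge_ends s t "mverts G"
  for s t :: "'e \<Rightarrow> 'v" and G :: "('v, 'e) multigraph" +
  assumes finite_multigraph: "finite_multigraph G"
    and mends: "e \<in> medges G \<Longrightarrow> mends G e = {s e, t e}"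
    and not_loop: "e \<in> medges G \<Longrightarrow> s e \<noteq> t e"
begin

lemma finite_medges: "finite (medges G)"
  using finite_multigraph by (simp add: finite_multigraph_def)

lemma adj_eq_adj_rel: "A \<subseteq> medges G \<Longrightarrow> adj A = adj_rel (G\<lparr>medges := A\<rparr>)"
  using mends by (fastforce simp: adj_def adj_rel_def doubleton_eq_iff)

lemma loopless: "loopless_in (medges G) {}"
  using not_loop by (auto simp: loopless_in_def spanned_iff conn_def adj_def)

lemma bridgeless:
  assumes "\<nexists>e. is_bridge G e"
  shows "bridgeless_in (medges G) {}"
  unfolding bridgeless_in_def
proof
  fix e assume e: "e \<in> medges G"
  then have "joined (delete_edge G e) (s e) (t e)"
    using assms mends by (auto simp: is_bridge_def)
  then show "spanned e (medges G - {e} \<union> {})"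
    by (simp add: joined_def delete_edge_def adj_eq_adj_rel[symmetric] spanned_iff conn_def)
qed

lemma simple_path:
  assumes "(u, v) \<in> conn A"
  shows "\<exists>vs es. length vs = Suc (length es) \<and> vs ! 0 = u \<and> vs ! length es = v \<and> distinct vs \<and>
    set es \<subseteq> A \<and> (\<forall>i<length es. {s (es ! i), t (es ! i)} = {vs ! i, vs ! Suc i})"
  using assms unfolding conn_def
proof (induction rule: rtrancl_induct)
  case base
  show ?case by (rule exI[of _ "[u]"], rule exI[of _ "[]"]) simp
next
  case (step v w)
  then obtain vs es where p: "length vs = Suc (length es)" "vs ! 0 = u" "vs ! length es = v"
    "distinct vs" "set es \<subseteq> A"
    and ends: "\<And>i. i < length es \<Longrightarrow> {s (es ! i), t (es ! i)} = {vs ! i, vs ! Suc i}" by blast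
  obtain e where e: "e \<in> A" "{s e, t e} = {v, w}" using step.hyps(2) by (auto simp: adj_def)
  show ?case
  proof (cases "w \<in> set vs")
    case True
    \<comment> \<open>The walk returns to a vertex of the path, so the path is cut back to that
      vertex.\<close>
    then obtain k where k: "k < length vs" "vs ! k = w" by (auto simp: in_set_conv_nth)
    then show ?thesis
      using p ends set_take_subset[of k es]
      by (intro exI[of _ "take (Suc k) vs"] exI[of _ "take k es"]) auto
  next
    case False
    have "{s ((es @ [e]) ! i), t ((es @ [e]) ! i)} = {(vs @ [w]) ! i, (vs @ [w]) ! Suc i}"
      if "i < Suc (length es)" for i
      using that p(1,3) ends[of i] e(2) by (auto simp: nth_append less_Suc_eq)
    then show ?thesis
      using p e(1) False
      by (intro exI[of _ "vs @ [w]"] exI[of _ "es @ [e]"]) (auto simp: nth_append)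
  qed
qed

text \<open>A simple path in \<open>T - {e}\<close> from \<open>t e\<close> to \<open>s e\<close> is
  closed up by \<open>e\<close>.\<close>

lemma cycle_of_spanned:
  assumes "T \<subseteq> medges G" "e \<in> T" "spanned e (T - {e})"
  shows "\<exists>vs es. is_cycle (spanning_subgraph G T) vs es"
proof -
  have "(t e, s e) \<in> conn (T - {e})" using assms(3) conn_sym by (simp add: spanned_iff)
  then obtain vs es where p: "length vs = Suc (length es)" "vs ! 0 = t e" "vs ! length es = s e"
    "distinct vs" "set es \<subseteq> T - {e}"
    and ends: "\<And>i. i < length es \<Longrightarrow> {s (es ! i), t (es ! i)} = {vs ! i, vs ! Suc i}"
    using simple_path by blast
  have inT: "es ! i \<in> medges G" if "i < length es" for i
    using p(5) assms(1) that nth_mem by blast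
  have V: "vs ! i \<in> mverts G" if "i < length vs" for i
  proof (cases "i < length es")
    case True
    then have "vs ! i \<in> {s (es ! i), t (es ! i)}" using ends by auto
    then show ?thesis using ends_in_V[of "es ! i"] not_loop[OF inT[OF True]] by auto
  next
    case False
    then show ?thesis
      using that p(1,3) ends_in_V[of e] not_loop[of e] assms(1,2) by (auto simp: less_Suc_eq)
  qed
  \<comment> \<open>Distinct vertices have distinct consecutive pairs, and the ends of an edge
    determine its pair.\<close>
  have "distinct es"
    unfolding distinct_conv_nth
  proof (intro allI impI notI)
    fix i j assume ij: "i < length es" "j < length es" "i \<noteq> j" "es ! i = es ! j"
    then have "{vs ! i, vs ! Suc i} = {vs ! j, vs ! Suc j}" using ends by metis
    then show False
      using ij p(1,4) by (auto simp: doubleton_eq_iff nth_eq_iff_index_eq)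
  qed
  then have "distinct (es @ [e])" using p(5) by auto
  moreover have "mends G ((es @ [e]) ! i) = {vs ! i, vs ! (Suc i mod length vs)}"
    if i: "i < length (es @ [e])" for i
  proof (cases "i < length es")
    case True
    then show ?thesis using p(1) ends[OF True] mends[OF inT[OF True]] by (simp add: nth_append)
  next
    case False
    then have "i = length es" using i by simp
    then show ?thesis using p(1-3) mends[of e] assms(1,2) by (auto simp: nth_append)
  qed
  moreover have "set vs \<subseteq> mverts G" using V by (auto simp: in_set_conv_nth)
  moreover have "set (es @ [e]) \<subseteq> T" using p(5) assms(2) by auto
  ultimately have "is_cycle (spanning_subgraph G T) vs (es @ [e])"
    using p(1,4) unfolding is_cycle_def spanning_subgraph_def by simp
  then show ?thesis by blast
qed

text \<open>A spanning tree is a base: the absence of cycles makes it independent and connectedness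
  gives it full rank.\<close>

lemma num_spanning_trees_le: "num_spanning_trees G \<le> tr (\<lambda>_. edge) (medges G) {}"
proof -
  have "{T. is_spanning_tree G T} \<subseteq>
    {T. T \<subseteq> medges G \<and> rank T = rank (medges G) \<and> rank T = card T + rank {}}"
  proof clarify
    fix T assume T: "is_spanning_tree G T"
    then have sub: "T \<subseteq> medges G" by (simp add: is_spanning_tree_def)
    have "\<not> spanned e (T - {e})" if "e \<in> T" for e
      using T cycle_of_spanned[OF sub that] by (auto simp: is_spanning_tree_def)
    then have forest: "rank T = card T + rank {}"
      using sub finite_medges finite_subset by (intro rank_forest) auto
    have "spanned e T" if "e \<in> medges G" for e
      using T that ends_in_V[of e] not_loop[OF that] adj_eq_adj_rel[OF sub]
      by (simp add: is_spanning_tree_def connected_multigraph_def joined_def spanning_subgraph_def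
          spanned_iff conn_def)
    then have "rank (T \<union> medges G) = rank T" using finite_medges by (intro rank_Un_spanned)
    then show "T \<subseteq> medges G \<and> rank T = rank (medges G) \<and> rank T = card T + rank {}"
      using forest sub by (simp add: Un_absorb1)
  qed
  then show ?thesis
    unfolding num_spanning_trees_def tr_unlabelled[OF finite_medges]
    using finite_medges by (intro of_nat_mono card_mono) auto
qed

section \<open>Orientations as digraphs\<close>

definition orient :: "'e set \<Rightarrow> 'e \<Rightarrow> 'v \<times> 'v" where
  "orient B = restrict (dart B) (medges G)"

lemma orient_in_orientations: "orient B \<in> orientations G"
  using mends by (auto simp: orient_def orientations_def dart_def insert_commute)

lemma inj_on_orient: "inj_on orient (Pow (medges G))"
proof (rule inj_onI)
  fix A B assume AB: "A \<in> Pow (medges G)" "B \<in> Pow (medges G)" "orient A = orient B"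
  have "e \<in> A \<longleftrightarrow> e \<in> B" if "e \<in> medges G" for e
    using fun_cong[OF AB(3), of e] that not_loop[OF that]
    by (auto simp: orient_def dart_def split: if_splits)
  then show "A = B" using AB(1,2) by blast
qed

lemma finite_orientations: "finite (orientations G)"
  unfolding orientations_def
proof (rule finite_PiE[OF finite_medges])
  fix e assume "e \<in> medges G"
  then have "{(u, v). mends G e = {u, v}} \<subseteq> {s e, t e} \<times> {s e, t e}"
    by (auto simp: mends)
  then show "finite {(u, v). mends G e = {u, v}}" by (rule finite_subset) simp
qed

lemma oriented_simps:
  "verts (oriented G (orient B)) = mverts G" "arcs (oriented G (orient B)) = medges G"
  "e \<in> medges G \<Longrightarrow> tail (oriented G (orient B)) e = fst (dart B e)"
  "e \<in> medges G \<Longrightarrow> head (oriented G (orient B)) e = snd (dart B e)"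
  by (simp_all add: oriented_def orient_def)

lemma wf_oriented: "wf_digraph (oriented G (orient B))"
  using ends_in_V not_loop by unfold_locales (auto simp: oriented_def orient_def dart_def)

lemma rtrancl_of_awalk:
  assumes "pre_digraph.awalk (oriented G (orient B)) u p v"
  shows "(u, v) \<in> (dart B ` medges G)\<^sup>*"
  using assms
proof (induction p arbitrary: u)
  case Nil
  then show ?case by (simp add: pre_digraph.awalk_def pre_digraph.cas.simps)
next
  case (Cons e p)
  interpret wf_digraph "oriented G (orient B)" by (rule wf_oriented)
  have e: "e \<in> medges G" "u = fst (dart B e)" "awalk (snd (dart B e)) p v"
    using Cons.prems by (auto simp: awalk_Cons_iff oriented_simps)
  have "(u, snd (dart B e)) \<in> dart B ` medges G" using e(1,2) by (auto intro: rev_image_eqI)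
  then show ?case using Cons.IH[OF e(3)] by (rule converse_rtrancl_into_rtrancl)
qed

lemma awalk_of_rtrancl:
  assumes "(u, v) \<in> (dart B ` medges G)\<^sup>*" "v \<in> mverts G"
  shows "\<exists>p. pre_digraph.awalk (oriented G (orient B)) u p v"
proof -
  interpret wf_digraph "oriented G (orient B)" by (rule wf_oriented)
  show ?thesis
    using assms(1)
  proof (induction rule: converse_rtrancl_induct)
    case base
    then show ?case using assms(2) by (intro exI[of _ "[]"]) (simp add: awalk_Nil_iff oriented_simps)
  next
    case (step x y)
    then obtain e p where "e \<in> medges G" "(x, y) = dart B e" "awalk y p v" by auto
    then have "awalk x (e # p) v" by (cases "dart B e") (auto simp: awalk_Cons_iff oriented_simps)
    then show ?case by blast
  qed
qed

lemma acyclic_orient: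
  assumes "B \<in> acyclics (medges G) {}"
  shows "acyclic_orientation G (orient B)"
  unfolding acyclic_orientation_def
proof (intro conjI notI)
  interpret wf_digraph "oriented G (orient B)" by (rule wf_oriented)
  assume "\<exists>c. cycle c"
  then obtain u e p where "awalk u (e # p) u" unfolding cycle_def by (metis list.exhaust)
  then have e: "e \<in> medges G" and "awalk (snd (dart B e)) p (fst (dart B e))"
    by (auto simp: awalk_Cons_iff oriented_simps)
  then have "(snd (dart B e), fst (dart B e)) \<in> (dart B ` medges G)\<^sup>*" using rtrancl_of_awalk by blast
  then show False
    using assms e by (force simp: acyclics_def no_closed_walk_def adj_def)
qed (rule orient_in_orientations)

lemma totally_cyclic_orient:
  assumes "B \<in> totally_cyclics (medges G) {}"
  shows "totally_cyclic_orientation G (orient B)"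
  unfolding totally_cyclic_orientation_def
proof (intro conjI ballI)
  interpret wf_digraph "oriented G (orient B)" by (rule wf_oriented)
  fix e assume e: "e \<in> medges G"
  then have "(snd (dart B e), fst (dart B e)) \<in> (dart B ` medges G)\<^sup>*"
    using assms by (force simp: totally_cyclics_def all_closed_walk_def adj_def)
  moreover have "fst (dart B e) \<in> mverts G"
    using ends_in_V[of e] not_loop[OF e] by (auto simp: dart_def)
  ultimately obtain p where "awalk (snd (dart B e)) p (fst (dart B e))"
    using awalk_of_rtrancl by blast
  \<comment> \<open>Shortening the return walk to a path makes \<open>e # q\<close> a cycle with
    distinct vertices instead of a mere closed walk.\<close>
  then obtain q where q: "apath (snd (dart B e)) q (fst (dart B e))"
    using reachable_apath reachable_awalk by blast
  have "awalk (fst (dart B e)) (e # q) (fst (dart B e))"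
    using q e by (auto simp: apath_def awalk_Cons_iff oriented_simps)
  moreover have "distinct (tl (awalk_verts (fst (dart B e)) (e # q)))"
    using q e by (auto simp: apath_def oriented_simps)
  ultimately have "cycle (e # q)" unfolding cycle_def by blast
  then show "\<exists>c. cycle c \<and> e \<in> set c" by (intro exI[of _ "e # q"]) simp
qed (rule orient_in_orientations)

lemma card_acyclics_le: "card (acyclics (medges G) {}) \<le> num_acyclic_orientations G"
  unfolding num_acyclic_orientations_def
proof (rule card_inj_on_le[of orient])
  show "inj_on orient (acyclics (medges G) {})"
    by (rule inj_on_subset[OF inj_on_orient]) (auto simp: acyclics_def)
  show "orient ` acyclics (medges G) {} \<subseteq> {\<omega>. acyclic_orientation G \<omega>}"
    using acyclic_orient by auto
  show "finite {\<omega>. acyclic_orientation G \<omega>}"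
    by (rule finite_subset[OF _ finite_orientations]) (auto simp: acyclic_orientation_def)
qed

lemma card_totally_cyclics_le:
  "card (totally_cyclics (medges G) {}) \<le> num_totally_cyclic_orientations G"
  unfolding num_totally_cyclic_orientations_def
proof (rule card_inj_on_le[of orient])
  show "inj_on orient (totally_cyclics (medges G) {})"
    by (rule inj_on_subset[OF inj_on_orient]) (auto simp: totally_cyclics_def)
  show "orient ` totally_cyclics (medges G) {} \<subseteq> {\<omega>. totally_cyclic_orientation G \<omega>}"
    using totally_cyclic_orient by auto
  show "finite {\<omega>. totally_cyclic_orientation G \<omega>}"
    by (rule finite_subset[OF _ finite_orientations]) (auto simp: totally_cyclic_orientation_def)
qed

end

lemma multigraph_ends_exist:
  assumes "finite_multigraph G" "\<nexists>e. is_loop G e"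
  shows "\<exists>s t. multigraph_ends s t G"
proof -
  \<comment> \<open>The rank function refers to all elements of the edge type, so values outside the
    graph are made loops at an arbitrary point.\<close>
  have "\<exists>p. if e \<in> medges G then mends G e = {fst p, snd p} \<and> fst p \<noteq> snd p else fst p = snd p" for e
  proof (cases "e \<in> medges G")
    case True
    then have "card (mends G e) = 2"
      using assms by (auto simp: finite_multigraph_def is_loop_def)
    then obtain u v where "mends G e = {u, v}" "u \<noteq> v" by (auto simp: card_2_iff)
    then show ?thesis using True by (intro exI[of _ "(u, v)"]) simp
  qed auto
  then obtain p where p: "\<And>e. if e \<in> medges G then mends G e = {fst (p e), snd (p e)} \<and>
      fst (p e) \<noteq> snd (p e) else fst (p e) = snd (p e)"
    by metis
  have "multigraph_ends (\<lambda>e. fst (p e)) (\<lambda>e. snd (p e)) G"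
  proof
    show "finite (mverts G)" "finite_multigraph G" using assms(1) by (simp_all add: finite_multigraph_def)
    show "mends G e = {fst (p e), snd (p e)}" "fst (p e) \<noteq> snd (p e)" if "e \<in> medges G" for e
      using p[of e] that by auto
    show "fst (p e) \<in> mverts G \<and> snd (p e) \<in> mverts G" if "fst (p e) \<noteq> snd (p e)" for e
      using p[of e] that assms(1) by (auto simp: finite_multigraph_def split: if_splits)
  qed
  then show ?thesis by blast
qed

theorem theorem4p5:
  fixes G :: "('v, 'e) multigraph"
  assumes "finite_multigraph G"
    and "series_parallel G"
    and "\<nexists>e. is_loop G e"
    and "\<nexists>e. is_bridge G e"
  shows "num_acyclic_orientations G * num_totally_cyclic_orientations G
           \<ge> (num_spanning_trees G)\<^sup>2"
proof -
  obtain s t where "multigraph_ends s t G"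
    using multigraph_ends_exist[OF assms(1,3)] by blast
  then interpret multigraph_ends s t G .
  let ?w = "\<lambda>_ :: 'e. edge" and ?E = "medges G"
  have basic: "?w e \<in> basic" for e by (rule basic_members)
  have reducible: "reducible E C"
    if EC: "E \<subseteq> ?E" "C \<subseteq> ?E" "E \<noteq> {}" "loopless_in E C" "bridgeless_in E C" for E C
  proof (rule ccontr)
    assume "\<not> reducible E C"
    then obtain P where P: "K4_model (adj (E \<union> C)) P"
      using K4_model_of_irreducible[OF finite_subset[OF EC(1) finite_medges] EC(3-5)] by blast
    have "adj (E \<union> C) \<subseteq> adj ?E" using EC(1,2) by (auto simp: adj_def)
    then have "K4_model (adj ?E) P" by (intro K4_model_mono[OF P]) auto
    moreover have "adj ?E = adj_rel G" using adj_eq_adj_rel[of ?E] by simp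
    ultimately have "has_minor G (complete_multigraph 4)"
      using has_K4_minor_of_model[OF assms(1)] by simp
    then show False using assms(2) by (simp add: series_parallel_def)
  qed
  have "inequality ?w ?E {}"
    by (rule inequality_of_reducible[OF finite_medges order_refl empty_subsetI loopless
          bridgeless[OF assms(4)] basic reducible])
  then have "(tr ?w ?E {})\<^sup>2 \<le> ac ?w ?E {} * tc ?w ?E {}"
    by (simp add: inequality_def)
  moreover have "(real (num_spanning_trees G))\<^sup>2 \<le> (tr ?w ?E {})\<^sup>2"
    using num_spanning_trees_le by (intro power_mono) auto
  moreover have "ac ?w ?E {} * tc ?w ?E {} \<le>
      real (num_acyclic_orientations G) * real (num_totally_cyclic_orientations G)"
  proof (rule mult_mono)
    show "ac ?w ?E {} \<le> real (num_acyclic_orientations G)"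
      using ac_le_card_acyclics[OF finite_medges, of "{}"] card_acyclics_le by simp
    show "tc ?w ?E {} \<le> real (num_totally_cyclic_orientations G)"
      using tc_le_card_totally_cyclics[OF finite_medges, of "{}"] card_totally_cyclics_le by simp
    show "0 \<le> tc ?w ?E {}" using tc_mono(1)[OF finite_medges basic] .
  qed simp
  ultimately have "real ((num_spanning_trees G)\<^sup>2) \<le>
      real (num_acyclic_orientations G * num_totally_cyclic_orientations G)"
    by simp
  then show ?thesis by (simp only: of_nat_le_iff)
qed

end
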